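(* Let $H$ and $G$ be Lie groups, $\mathfrak g$ the Lie algebra of $G$, $\phi:H\to G$ a Lie group homomorphism, and $(\phi_\varepsilon)_{\varepsilon\in I}$ a deformation of $\phi$. Then for each $\lambda\in I$ we obtain a $1$-cocycle $$X_\lambda:H\to\mathfrak g,\qquad X_\lambda(h)=d_{\phi_\lambda(h)}R_{\phi_\lambda(h)^{-1}}\Big(\frac{d}{d\varepsilon}\Big|_{\varepsilon=\lambda}\phi_\varepsilon(h)\Big)$$ in the complex $(C^*_{\phi_\lambda}(H,\mathfrak g),\delta_{\phi_\lambda})$ which computes the differentiable cohomology of $H$ with coefficients in the pullback by $\phi_\lambda$ of the adjoint representation of $G$. Moreover, under the completeness assumption described in the context, the deformation $(\phi_\varepsilon)_{\varepsilon\in I}$ is trivial if and only if the family of $1$-cocycles $X_\lambda$, $\lambda\in I$, can be smoothly transgressed (i.e., the cohomology classes $[X_\lambda]\in H^1_{\phi_\lambda}(H,\mathfrak g)$ vanish in a smooth manner).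
   Context: $I\subset\mathbb R$ is an interval containing $0$. $R_g$ denotes right translation by $g$ in $G$. Deformation: a deformation of $\phi$ is a smooth family of Lie group homomorphisms $\phi_\varepsilon:H\to G$, $\varepsilon\in I$, with $\phi_0=\phi$. Triviality: the deformation is trivial if there exists a smooth curve $I\to G$, $\varepsilon\mapsto g_\varepsilon$, starting at the identity ($g_0=1$), such that $\phi_\varepsilon(h)=g_\varepsilon\phi(h)g_\varepsilon^{-1}$ for all $h\in H$ and all $\varepsilon\in I$. Cohomology: for a representation $\rho:H\to GL(V)$, $C^k(H,V)$ is the space of smooth maps $H^k\to V$ (with $C^0(H,V)=V$), and the differential is $$\delta_\rho c(h_1,\dots,h_{k+1})=\rho(h_1)c(h_2,\dots,h_{k+1})+\sum_{i=1}^k(-1)^ic(h_1,\dots,h_ih_{i+1},\dots,h_{k+1})+(-1)^{k+1}c(h_1,\dots,h_k).$$ In particular, for $u\in V$, $\delta_\rho(u)(h)=\rho(h)u-u$. For a homomorphism $\psi:H\to G$, $C^*_\psi(H,\mathfrak g)$, $\delta_\psi$ and $H^*_\psi(H,\mathfrak g)$ denote the complex, differential and cohomology for $V=\mathfrak g$ and $\rho=\mathrm{Ad}\circ\psi$. Smooth transgression: the family $X_\lambda$ can be smoothly transgressed (equivalently, the classes $[X_\lambda]$ vanish smoothly) if there exists a smooth curve $I\to\mathfrak g$, $\lambda\mapsto u_\lambda$, such that $\delta_{\phi_\lambda}(u_\lambda)=X_\lambda$ for all $\lambda\in I$; such a curve is called a smooth transgression. Completeness assumption: for a smooth transgression $u_\lambda$,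 the integral curve starting at the identity $1\in G$ at time $0$ of the time-dependent right-invariant vector field on $G$ whose value at the identity at time $\lambda$ is $-u_\lambda$ is defined for all times in $I$. *)

theory Defs
  imports
    "HOL-Analysis.Analysis"
    "HOL-Algebra.Group"
    "HOL-Library.Function_Algebras"
begin

text \<open>Meant for open \<open>U\<close>. All domains below are finite dimensional, or the function depends only
  on finitely many coordinates in a finite-dimensional space; there, continuity of all iterated
  directional derivatives is the usual notion of being of class \<open>C\<^sup>k\<close>.\<close>

primrec Ck_on ::
  "nat \<Rightarrow> 'a set \<Rightarrow> ('a::real_normed_vector \<Rightarrow> 'b::real_normed_vector) \<Rightarrow> bool" where
  "Ck_on 0 U f \<longleftrightarrow> continuous_on U f"
| "Ck_on (Suc k) U f \<longleftrightarrow>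
     (\<forall>x\<in>U. f differentiable (at x)) \<and> (\<forall>v. Ck_on k U (\<lambda>x. frechet_derivative f (at x) v))"

text \<open>On an arbitrary set, smoothness means the existence of local smooth extensions. This is what
  covers intervals with end points.\<close>

definition smooth_on ::
  "'a set \<Rightarrow> ('a::real_normed_vector \<Rightarrow> 'b::real_normed_vector) \<Rightarrow> bool" where
  "smooth_on S f \<longleftrightarrow>
     (\<forall>x\<in>S. \<exists>U F. open U \<and> x \<in> U \<and> (\<forall>k. Ck_on k U F) \<and> (\<forall>y\<in>S \<inter> U. F y = f y))"

type_synonym ('m, 'e) chart = "'m set \<times> ('m \<Rightarrow> 'e)"

record ('m, 'e) manifold =
  mtop :: "'m topology"
  atlas :: "('m, 'e) chart set"

definition chart_inv :: "('m, 'e) chart \<Rightarrow> 'e \<Rightarrow> 'm" where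
  "chart_inv c = inv_into (fst c) (snd c)"

text \<open>The model space is a finite-dimensional normed space rather than a type of class
  \<open>euclidean_space\<close>, because the latter class excludes dimension 0, hence discrete groups.\<close>

locale smooth_manifold =
  fixes M :: "('m, 'e::real_normed_vector) manifold"
  assumes finite_dim: "\<exists>B::'e set. finite B \<and> span B = UNIV"
    and Hausdorff: "Hausdorff_space (mtop M)"
    and second_countable: "second_countable (mtop M)"
    and atlas_covers: "(\<Union>c\<in>atlas M. fst c) = topspace (mtop M)"
    and chart_open: "c \<in> atlas M \<Longrightarrow> openin (mtop M) (fst c) \<and> open (snd c ` fst c)"
    and chart_homeomorphic: "c \<in> atlas M \<Longrightarrow>
      homeomorphic_map (subtopology (mtop M) (fst c)) (top_of_set (snd c ` fst c)) (snd c)"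
    and charts_compatible: "c \<in> atlas M \<Longrightarrow> d \<in> atlas M \<Longrightarrow>
      smooth_on (snd c ` (fst c \<inter> fst d)) (snd d \<circ> chart_inv c)"

definition real_manifold :: "(real, real) manifold" where
  "real_manifold = \<lparr>mtop = euclidean, atlas = {(UNIV, id)}\<rparr>"

definition prod_manifold ::
  "('m, 'e) manifold \<Rightarrow> ('n, 'f) manifold \<Rightarrow> ('m \<times> 'n, 'e \<times> 'f) manifold" where
  "prod_manifold M N =
     \<lparr>mtop = prod_topology (mtop M) (mtop N),
      atlas = {(fst c \<times> fst d, map_prod (snd c) (snd d)) | c d. c \<in> atlas M \<and> d \<in> atlas N}\<rparr>"

definition smooth_map_on ::
  "('m, 'e::real_normed_vector) manifold \<Rightarrow> 'm set \<Rightarrow> ('n, 'f::real_normed_vector) manifold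
    \<Rightarrow> ('m \<Rightarrow> 'n) \<Rightarrow> bool" where
  "smooth_map_on M S N f \<longleftrightarrow>
     S \<subseteq> topspace (mtop M) \<and> continuous_map (subtopology (mtop M) S) (mtop N) f \<and>
     (\<forall>c\<in>atlas M. \<forall>d\<in>atlas N.
        smooth_on (snd c ` {x \<in> S \<inter> fst c. f x \<in> fst d}) (snd d \<circ> f \<circ> chart_inv c))"

abbreviation smooth_map ::
  "('m, 'e::real_normed_vector) manifold \<Rightarrow> ('n, 'f::real_normed_vector) manifold
    \<Rightarrow> ('m \<Rightarrow> 'n) \<Rightarrow> bool" where
  "smooth_map M N \<equiv> smooth_map_on M (topspace (mtop M)) N"

text \<open>Smoothness of a map into a finite-dimensional linear subspace \<open>V\<close>: all its coordinates,
  equivalently all its compositions with linear functionals, are smooth.\<close>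

definition smooth_into_vector_space ::
  "('m, 'e::real_normed_vector) manifold \<Rightarrow> 'm set \<Rightarrow> 'v::real_vector set
    \<Rightarrow> ('m \<Rightarrow> 'v) \<Rightarrow> bool" where
  "smooth_into_vector_space M S V f \<longleftrightarrow>
     f ` S \<subseteq> V \<and> (\<forall>l::'v \<Rightarrow> real. linear l \<longrightarrow> smooth_map_on M S real_manifold (l \<circ> f))"

definition tuples :: "'a set \<Rightarrow> nat \<Rightarrow> 'a list set" where
  "tuples A k = {xs. length xs = k \<and> set xs \<subseteq> A}"

text \<open>Smoothness of a real function on the \<open>k\<close>-fold power of \<open>M\<close>, whose points are the lists of
  length \<open>k\<close>, tested in the product charts. These take values in the \<open>k\<close>-fold power of the model
  space; as \<open>k\<close> is not a type, a point of that power is given by the first \<open>k\<close> entries of a bounded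
  sequence, and the remaining entries are irrelevant.\<close>

definition smooth_on_power ::
  "('m, 'e::real_normed_vector) manifold \<Rightarrow> nat \<Rightarrow> ('m list \<Rightarrow> real) \<Rightarrow> bool" where
  "smooth_on_power M k f \<longleftrightarrow>
     (\<forall>cs\<in>tuples (atlas M) k.
        smooth_on {x :: nat \<Rightarrow>\<^sub>C 'e. \<forall>i<k. apply_bcontfun x i \<in> snd (cs ! i) ` fst (cs ! i)}
          (\<lambda>x. f (map (\<lambda>i. chart_inv (cs ! i) (apply_bcontfun x i)) [0..<k])))"

instantiation "fun" :: (type, real_vector) real_vector
begin

definition scaleR_fun :: "real \<Rightarrow> ('a \<Rightarrow> 'b) \<Rightarrow> 'a \<Rightarrow> 'b" where
  "scaleR_fun r f = (\<lambda>x. r *\<^sub>R f x)"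

instance
  by standard (auto simp: scaleR_fun_def fun_eq_iff scaleR_add_right scaleR_add_left)

end

text \<open>A tangent vector at \<open>p\<close> is the family of its coordinate expressions in all charts of the atlas
  around \<open>p\<close>, which transform by the derivatives of the changes of coordinates.\<close>

type_synonym ('m, 'e) tangent = "('m, 'e) chart \<Rightarrow> 'e"

definition charts_at :: "('m, 'e) manifold \<Rightarrow> 'm \<Rightarrow> ('m, 'e) chart set" where
  "charts_at M p = {c \<in> atlas M. p \<in> fst c}"

definition tangent_space ::
  "('m, 'e::real_normed_vector) manifold \<Rightarrow> 'm \<Rightarrow> ('m, 'e) tangent set" where
  "tangent_space M p =
     {v. (\<forall>c\<in>charts_at M p. \<forall>d\<in>charts_at M p.
            v d = frechet_derivative (snd d \<circ> chart_inv c) (at (snd c p)) (v c)) \<and>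
         (\<forall>c. c \<notin> charts_at M p \<longrightarrow> v c = 0)}"

definition tangent_map ::
  "('m, 'e::real_normed_vector) manifold \<Rightarrow> ('n, 'f::real_normed_vector) manifold
    \<Rightarrow> ('m \<Rightarrow> 'n) \<Rightarrow> 'm \<Rightarrow> ('m, 'e) tangent \<Rightarrow> ('n, 'f) tangent" where
  "tangent_map M N f p v =
     (let c = (SOME c. c \<in> charts_at M p) in
       (\<lambda>d. if d \<in> charts_at N (f p)
            then frechet_derivative (snd d \<circ> f \<circ> chart_inv c) (at (snd c p)) (v c) else 0))"

text \<open>At an end point of \<open>I\<close> the derivative is one-sided.\<close>

definition velocity ::
  "('m, 'e::real_normed_vector) manifold \<Rightarrow> real set \<Rightarrow> (real \<Rightarrow> 'm) \<Rightarrow> real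
    \<Rightarrow> ('m, 'e) tangent" where
  "velocity M I \<gamma> t =
     (\<lambda>c. if c \<in> charts_at M (\<gamma> t) then vector_derivative (snd c \<circ> \<gamma>) (at t within I) else 0)"

text \<open>Integral curves are smooth by definition; for smooth fields this is no restriction.\<close>

definition integral_curve ::
  "('m, 'e::real_normed_vector) manifold \<Rightarrow> real set \<Rightarrow> (real \<Rightarrow> 'm \<Rightarrow> ('m, 'e) tangent)
    \<Rightarrow> (real \<Rightarrow> 'm) \<Rightarrow> bool" where
  "integral_curve M I Y \<gamma> \<longleftrightarrow>
     smooth_map_on real_manifold I M \<gamma> \<and> (\<forall>t\<in>I. velocity M I \<gamma> t = Y t (\<gamma> t))"

record ('g, 'e) lie_group_data = "'g monoid" +
  mfd :: "('g, 'e) manifold"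

locale lie_group = group G
  for G :: "('g, 'e::real_normed_vector) lie_group_data" (structure) +
  assumes manifold: "smooth_manifold (mfd G)"
    and topspace_eq_carrier: "topspace (mtop (mfd G)) = carrier G"
    and smooth_mult: "smooth_map (prod_manifold (mfd G) (mfd G)) (mfd G) (\<lambda>(x, y). x \<otimes> y)"
    and smooth_inv: "smooth_map (mfd G) (mfd G) (\<lambda>x. inv x)"

definition lie_group_hom ::
  "('h, 'e::real_normed_vector) lie_group_data \<Rightarrow> ('g, 'f::real_normed_vector) lie_group_data
    \<Rightarrow> ('h \<Rightarrow> 'g) \<Rightarrow> bool" where
  "lie_group_hom H G \<phi> \<longleftrightarrow> \<phi> \<in> hom H G \<and> smooth_map (mfd H) (mfd G) \<phi>"

abbreviation lie_algebra ::
  "('g, 'e::real_normed_vector) lie_group_data \<Rightarrow> ('g, 'e) tangent set" where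
  "lie_algebra G \<equiv> tangent_space (mfd G) \<one>\<^bsub>G\<^esub>"

definition right_translation :: "('g, 'e) lie_group_data \<Rightarrow> 'g \<Rightarrow> 'g \<Rightarrow> 'g" where
  "right_translation G g = (\<lambda>x. x \<otimes>\<^bsub>G\<^esub> g)"

definition Ad ::
  "('g, 'e::real_normed_vector) lie_group_data \<Rightarrow> 'g \<Rightarrow> ('g, 'e) tangent \<Rightarrow> ('g, 'e) tangent" where
  "Ad G g = tangent_map (mfd G) (mfd G) (\<lambda>x. g \<otimes>\<^bsub>G\<^esub> x \<otimes>\<^bsub>G\<^esub> inv\<^bsub>G\<^esub> g) \<one>\<^bsub>G\<^esub>"

definition right_invariant_field ::
  "('g, 'e::real_normed_vector) lie_group_data \<Rightarrow> ('g, 'e) tangent \<Rightarrow> 'g \<Rightarrow> ('g, 'e) tangent" where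
  "right_invariant_field G u g =
     tangent_map (mfd G) (mfd G) (right_translation G g) \<one>\<^bsub>G\<^esub> u"

definition cochains ::
  "('h, 'e::real_normed_vector) lie_group_data \<Rightarrow> 'v::real_vector set \<Rightarrow> nat
    \<Rightarrow> ('h list \<Rightarrow> 'v) set" where
  "cochains H V k =
     {c. c ` tuples (carrier H) k \<subseteq> V \<and>
         (\<forall>l::'v \<Rightarrow> real. linear l \<longrightarrow> smooth_on_power (mfd H) k (l \<circ> c))}"

text \<open>Lists are indexed from 0: the summand for \<open>i\<close> replaces \<open>h\<^sub>i\<close> and \<open>h\<^sub>i\<^sub>+\<^sub>1\<close>, which are
  \<open>hs ! (i - 1)\<close> and \<open>hs ! i\<close>, by their product.\<close>

definition differential ::
  "('h, 'e) lie_group_data \<Rightarrow> ('h \<Rightarrow> 'v \<Rightarrow> 'v::real_vector) \<Rightarrow> nat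
    \<Rightarrow> ('h list \<Rightarrow> 'v) \<Rightarrow> 'h list \<Rightarrow> 'v" where
  "differential H \<rho> k c hs =
     \<rho> (hs ! 0) (c (tl hs))
     + (\<Sum>i=1..k. (- 1) ^ i *\<^sub>R c (take (i - 1) hs @ [hs ! (i - 1) \<otimes>\<^bsub>H\<^esub> hs ! i] @ drop (i + 1) hs))
     + (- 1) ^ (k + 1) *\<^sub>R c (butlast hs)"

definition cocycles ::
  "('h, 'e::real_normed_vector) lie_group_data \<Rightarrow> 'v::real_vector set \<Rightarrow> ('h \<Rightarrow> 'v \<Rightarrow> 'v) \<Rightarrow> nat
    \<Rightarrow> ('h list \<Rightarrow> 'v) set" where
  "cocycles H V \<rho> k =
     {c \<in> cochains H V k. \<forall>hs\<in>tuples (carrier H) (k + 1). differential H \<rho> k c hs = 0}"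

definition deformation ::
  "real set \<Rightarrow> ('h, 'e::real_normed_vector) lie_group_data
    \<Rightarrow> ('g, 'f::real_normed_vector) lie_group_data
    \<Rightarrow> ('h \<Rightarrow> 'g) \<Rightarrow> (real \<Rightarrow> 'h \<Rightarrow> 'g) \<Rightarrow> bool" where
  "deformation I H G \<phi> \<Phi> \<longleftrightarrow>
     (\<forall>\<epsilon>\<in>I. lie_group_hom H G (\<Phi> \<epsilon>)) \<and>
     smooth_map_on (prod_manifold real_manifold (mfd H)) (I \<times> carrier H) (mfd G)
       (\<lambda>(\<epsilon>, h). \<Phi> \<epsilon> h) \<and>
     (\<forall>h\<in>carrier H. \<Phi> 0 h = \<phi> h)"

definition trivial_deformation ::
  "real set \<Rightarrow> ('h, 'e::real_normed_vector) lie_group_data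
    \<Rightarrow> ('g, 'f::real_normed_vector) lie_group_data
    \<Rightarrow> ('h \<Rightarrow> 'g) \<Rightarrow> (real \<Rightarrow> 'h \<Rightarrow> 'g) \<Rightarrow> bool" where
  "trivial_deformation I H G \<phi> \<Phi> \<longleftrightarrow>
     (\<exists>g. smooth_map_on real_manifold I (mfd G) g \<and> g 0 = \<one>\<^bsub>G\<^esub> \<and>
       (\<forall>h\<in>carrier H. \<forall>\<epsilon>\<in>I. \<Phi> \<epsilon> h = g \<epsilon> \<otimes>\<^bsub>G\<^esub> \<phi> h \<otimes>\<^bsub>G\<^esub> inv\<^bsub>G\<^esub> (g \<epsilon>)))"

definition variation ::
  "real set \<Rightarrow> ('g, 'f::real_normed_vector) lie_group_data \<Rightarrow> (real \<Rightarrow> 'h \<Rightarrow> 'g)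
    \<Rightarrow> real \<Rightarrow> 'h \<Rightarrow> ('g, 'f) tangent" where
  "variation I G \<Phi> t h =
     tangent_map (mfd G) (mfd G) (right_translation G (inv\<^bsub>G\<^esub> (\<Phi> t h))) (\<Phi> t h)
       (velocity (mfd G) I (\<lambda>\<epsilon>. \<Phi> \<epsilon> h) t)"

text \<open>An element \<open>u\<close> of the Lie algebra is the 0-cochain with value \<open>u\<close> at the empty list.\<close>

definition smooth_transgression ::
  "real set \<Rightarrow> ('h, 'e::real_normed_vector) lie_group_data
    \<Rightarrow> ('g, 'f::real_normed_vector) lie_group_data
    \<Rightarrow> (real \<Rightarrow> 'h \<Rightarrow> 'g) \<Rightarrow> (real \<Rightarrow> ('g, 'f) tangent) \<Rightarrow> bool" where
  "smooth_transgression I H G \<Phi> u \<longleftrightarrow>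
     smooth_into_vector_space real_manifold I (lie_algebra G) u \<and>
     (\<forall>t\<in>I. \<forall>h\<in>carrier H.
        differential H (Ad G \<circ> \<Phi> t) 0 (\<lambda>_. u t) [h] = variation I G \<Phi> t h)"

definition complete_transgression ::
  "real set \<Rightarrow> ('g, 'f::real_normed_vector) lie_group_data \<Rightarrow> (real \<Rightarrow> ('g, 'f) tangent) \<Rightarrow> bool"
  where
  "complete_transgression I G u \<longleftrightarrow>
     (\<exists>\<gamma>. \<gamma> 0 = \<one>\<^bsub>G\<^esub> \<and>
       integral_curve (mfd G) I (\<lambda>t. right_invariant_field G (- u t)) \<gamma>)"

end

theory Submission
  imports Defs
begin

text \<open>
  The argument is a calculus of curves in \<open>G\<close>, based on the right logarithmic derivative: for a smooth
  curve \<open>\<gamma>\<close>, its value at \<open>t\<close> is the velocity at time \<open>t\<close> of \<open>x \<mapsto> \<gamma> x \<otimes> inv (\<gamma> t)\<close>, a curve that is at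
  the identity at time \<open>t\<close>, so that this velocity lies in the Lie algebra. It is called \<open>log_velocity\<close>
  below and written \<open>\<gamma>' \<gamma>\<^sup>-\<^sup>1\<close> in this explanation. Two facts about it carry the proof.

  \<^item> The product rule \<open>log_velocity_mult\<close>: \<open>(\<alpha> \<beta>)' (\<alpha> \<beta>)\<^sup>-\<^sup>1 = \<alpha>' \<alpha>\<^sup>-\<^sup>1 + Ad \<alpha> (\<beta>' \<beta>\<^sup>-\<^sup>1)\<close>.
  \<^item> Uniqueness, \<open>eq_if_log_velocity_eq\<close>: curves on an interval with the same logarithmic derivative that
    meet once are equal. By the product rule \<open>\<alpha>\<^sup>-\<^sup>1 \<beta>\<close> has logarithmic derivative zero, hence velocity zero,
    hence is constant.

  Let \<open>X\<^sub>t(h)\<close> denote \<open>variation I G \<Phi> t h\<close>. By the chain rule for the right translation it is the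
  logarithmic derivative at \<open>t\<close> of \<open>x \<mapsto> \<Phi> x h\<close>. Applying the product rule to
  \<open>\<Phi> x (h k) = \<Phi> x h \<otimes> \<Phi> x k\<close> gives \<open>X\<^sub>t(h k) = X\<^sub>t(h) + Ad (\<Phi> t h) (X\<^sub>t(k))\<close>, which is the cocycle identity.

  For the second part, triviality along a curve \<open>g\<close> means that the curves \<open>x \<mapsto> \<Phi> x h \<otimes> g x\<close> and
  \<open>x \<mapsto> g x \<otimes> \<phi> h\<close> agree. Let \<open>a = g' g\<^sup>-\<^sup>1\<close>. By the product rule the logarithmic derivatives of these two
  curves are \<open>X\<^sub>t(h) + Ad (\<Phi> t h) a\<^sub>t\<close> and \<open>a\<^sub>t\<close>, so they coincide for all \<open>h\<close> exactly when \<open>- a\<close> satisfies the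
  transgression equation. If the deformation is trivial, this makes \<open>- a\<close> a transgression
  (\<open>trivial_imp_transgression\<close>). Conversely, given a transgression \<open>u\<close>, completeness provides a curve \<open>g\<close>
  from the identity with \<open>g' g\<^sup>-\<^sup>1 = - u\<close>, and uniqueness shows that the two curves, which both start at
  \<open>\<phi> h\<close>, agree (\<open>transgression_imp_trivial\<close>).

  The remaining work is analytic. Smoothness of \<open>X\<^sub>t\<close> in \<open>h\<close> and of \<open>a\<^sub>t\<close> in \<open>t\<close> are two instances of one
  statement: the velocities, at one common point, of a smooth family of curves depend smoothly on the
  parameter (\<open>smooth_velocity_family\<close>). It rests on the calculus of \<open>C\<^sup>k\<close> maps between finite-dimensional
  normed spaces, where finite dimension makes linear maps continuous and turns the chain rule into a
  finite sum over coordinates, so that composites of \<open>C\<^sup>k\<close> maps are \<open>C\<^sup>k\<close>.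
\<close>

section \<open>Finite-dimensional normed spaces\<close>

text \<open>Completeness and boundedness are proved together by adding one vector \<open>b\<close> at a time: as the span of \<open>B\<close> is
  complete, it is closed, so \<open>b\<close> has a positive distance \<open>\<delta>\<close> from it. Therefore the coefficient of \<open>b\<close> in
  any \<open>x\<close> has absolute value at most \<open>norm x / \<delta>\<close>, which controls both Cauchy sequences and linear maps on the larger span.\<close>

lemma finite_dim_span_bounded:
  fixes B :: "'a::real_normed_vector set"
  assumes "finite B"
  shows "complete (span B) \<and>
    (\<forall>f::'a \<Rightarrow> 'b::real_normed_vector. linear f \<longrightarrow> (\<exists>K. \<forall>x\<in>span B. norm (f x) \<le> K * norm x))"
  using assms
proof (induction B)
  case empty
  show ?case
    by (auto simp: linear_0 complete_def intro: tendsto_eventually always_eventually)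
next
  case (insert b B)
  show ?case
  proof (cases "b \<in> span B")
    case True
    then show ?thesis using insert by (simp add: span_redundant)
  next
    case False
    have compl: "complete (span B)" using insert.IH by simp
    then have "closed (span B)" by (rule complete_imp_closed)
    then have "open (- span B)" by blast
    then obtain \<delta> where \<delta>: "\<delta> > 0" "ball b \<delta> \<subseteq> - span B"
      using False open_contains_ball[of "- span B"] by blast
    have dist_span: "\<delta> \<le> norm (b - y)" if "y \<in> span B" for y
      using \<delta> that by (force simp: dist_norm)
    \<comment> \<open>This bounds the coefficient of \<open>b\<close>: dividing \<open>x\<close> by \<open>s\<close> gives \<open>b\<close> minus a vector of the span.\<close>
    have coeff: "\<bar>s\<bar> * \<delta> \<le> norm x" if "x - s *\<^sub>R b \<in> span B" for x s
    proof (cases "s = 0")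
      case False
      have "(-1 / s) *\<^sub>R (x - s *\<^sub>R b) \<in> span B" using that by (rule span_scale)
      from dist_span[OF this] have "\<delta> \<le> norm ((1 / s) *\<^sub>R x)"
        using False by (simp add: algebra_simps)
      then have "\<delta> \<le> norm x / \<bar>s\<bar>" by simp
      then show ?thesis using False by (simp add: field_simps)
    qed simp
    have "complete (span (insert b B))"
      unfolding complete_def
    proof (intro allI impI)
      fix X :: "nat \<Rightarrow> 'a"
      assume X: "(\<forall>n. X n \<in> span (insert b B)) \<and> Cauchy X"
      then have "\<forall>n. \<exists>s. X n - s *\<^sub>R b \<in> span B" by (simp add: span_breakdown_eq)
      then obtain s where s: "\<And>n. X n - s n *\<^sub>R b \<in> span B" by metis
      have sd: "\<bar>s m - s n\<bar> * \<delta> \<le> norm (X m - X n)" for m n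
        by (rule coeff) (use span_diff[OF s[of m] s[of n]] in \<open>simp add: algebra_simps\<close>)
      have "Cauchy s"
      proof (rule metric_CauchyI)
        fix e :: real assume "e > 0"
        then have "e * \<delta> > 0" using \<delta> by simp
        then obtain N where "\<forall>m\<ge>N. \<forall>n\<ge>N. dist (X m) (X n) < e * \<delta>"
          using X metric_CauchyD by blast
        then have "\<forall>m\<ge>N. \<forall>n\<ge>N. dist (s m) (s n) < e"
          using sd \<delta> by (smt (verit) dist_norm dist_real_def mult_less_cancel_right)
        then show "\<exists>N. \<forall>m\<ge>N. \<forall>n\<ge>N. dist (s m) (s n) < e" by blast
      qed
      then obtain l where l: "s \<longlonglongrightarrow> l" using real_Cauchy_convergent convergent_def by blast
      have "Cauchy (\<lambda>n. s n *\<^sub>R b)"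
        by (rule LIMSEQ_imp_Cauchy) (rule tendsto_scaleR[OF l tendsto_const])
      have "Cauchy (\<lambda>n. X n - s n *\<^sub>R b)"
      proof (rule metric_CauchyI)
        fix e :: real assume "e > 0"
        then have "e / 2 > 0" by simp
        then obtain N N' where N: "\<forall>m\<ge>N. \<forall>n\<ge>N. dist (X m) (X n) < e / 2"
          and N': "\<forall>m\<ge>N'. \<forall>n\<ge>N'. dist (s m *\<^sub>R b) (s n *\<^sub>R b) < e / 2"
          using X \<open>Cauchy (\<lambda>n. s n *\<^sub>R b)\<close> metric_CauchyD by metis
        have "dist (X m - s m *\<^sub>R b) (X n - s n *\<^sub>R b) < e" if "m \<ge> max N N'" "n \<ge> max N N'" for m n
        proof -
          have "dist (X m - s m *\<^sub>R b) (X n - s n *\<^sub>R b)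
              \<le> dist (X m) (X n) + dist (s m *\<^sub>R b) (s n *\<^sub>R b)"
            using norm_triangle_ineq4[of "X m - X n" "s m *\<^sub>R b - s n *\<^sub>R b"]
            by (simp add: dist_norm algebra_simps)
          also have "\<dots> < e / 2 + e / 2" using N N' that by (intro add_strict_mono) auto
          finally show ?thesis by simp
        qed
        then show "\<exists>N. \<forall>m\<ge>N. \<forall>n\<ge>N. dist (X m - s m *\<^sub>R b) (X n - s n *\<^sub>R b) < e" by blast
      qed
      then obtain y where y: "y \<in> span B" "(\<lambda>n. X n - s n *\<^sub>R b) \<longlonglongrightarrow> y"
        using spec[OF compl[unfolded complete_def], of "\<lambda>n. X n - s n *\<^sub>R b"] s by auto
      have "(\<lambda>n. (X n - s n *\<^sub>R b) + s n *\<^sub>R b) \<longlonglongrightarrow> y + l *\<^sub>R b"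
        by (intro tendsto_intros y l)
      then have "X \<longlonglongrightarrow> y + l *\<^sub>R b" by simp
      moreover have "y + l *\<^sub>R b \<in> span (insert b B)"
        using y unfolding span_breakdown_eq by (intro exI[of _ l]) simp
      ultimately show "\<exists>l\<in>span (insert b B). X \<longlonglongrightarrow> l" by blast
    qed
    moreover have "\<exists>K. \<forall>x\<in>span (insert b B). norm (f x) \<le> K * norm x"
      if f: "linear f" for f :: "'a \<Rightarrow> 'b"
    proof -
      obtain K where K: "\<And>x. x \<in> span B \<Longrightarrow> norm (f x) \<le> K * norm x"
        using insert f by blast
      have Kpos: "norm (f x) \<le> \<bar>K\<bar> * norm x" if "x \<in> span B" for x
        using K[OF that] by (meson abs_ge_self mult_right_mono norm_ge_zero order_trans)
      show ?thesis
      proof (intro exI ballI)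
        fix x assume "x \<in> span (insert b B)"
        then obtain s where s: "x - s *\<^sub>R b \<in> span B" by (auto simp: span_breakdown_eq)
        have s_le: "\<bar>s\<bar> \<le> norm x / \<delta>" using coeff[OF s] \<delta> by (simp add: field_simps)
        have "norm (f x) = norm (f (x - s *\<^sub>R b) + s *\<^sub>R f b)"
          by (simp add: linear_diff[OF f] linear_scale[OF f])
        also have "\<dots> \<le> \<bar>K\<bar> * norm (x - s *\<^sub>R b) + \<bar>s\<bar> * norm (f b)"
          using Kpos[OF s] norm_triangle_ineq[of "f (x - s *\<^sub>R b)" "s *\<^sub>R f b"] by simp
        also have "\<dots> \<le> \<bar>K\<bar> * (norm x + \<bar>s\<bar> * norm b) + \<bar>s\<bar> * norm (f b)"
          using norm_triangle_ineq4[of x "s *\<^sub>R b"] by (simp add: mult_left_mono)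
        also have "\<dots> \<le> \<bar>K\<bar> * (norm x + norm x / \<delta> * norm b) + norm x / \<delta> * norm (f b)"
          by (intro add_mono mult_left_mono mult_right_mono s_le order_refl) auto
        also have "\<dots> = (\<bar>K\<bar> * (1 + norm b / \<delta>) + norm (f b) / \<delta>) * norm x"
          by (simp add: algebra_simps)
        finally show "norm (f x) \<le> (\<bar>K\<bar> * (1 + norm b / \<delta>) + norm (f b) / \<delta>) * norm x" .
      qed
    qed
    ultimately show ?thesis by blast
  qed
qed

text \<open>Dimension 0, that of the models of discrete groups, is included; the class \<open>euclidean_space\<close>
  excludes it.\<close>

definition finite_dim_type :: "'a::real_normed_vector itself \<Rightarrow> bool" where
  "finite_dim_type _ \<longleftrightarrow> (\<exists>B::'a set. finite B \<and> span B = UNIV)"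

lemma finite_dim_linear_bounded:
  fixes f :: "'a::real_normed_vector \<Rightarrow> 'b::real_normed_vector"
  assumes "finite_dim_type TYPE('a)" and f: "linear f"
  shows "bounded_linear f"
proof -
  obtain B :: "'a set" where B: "finite B" "span B = UNIV"
    using assms(1) by (auto simp: finite_dim_type_def)
  then obtain K where "\<And>x. norm (f x) \<le> K * norm x"
    using finite_dim_span_bounded[OF B(1)] f by (metis UNIV_I)
  then show ?thesis
    using f by (auto simp: bounded_linear_def bounded_linear_axioms_def mult.commute)
qed

text \<open>Continuous coordinate functionals are what the chain rule for \<open>C\<^sup>k\<close> maps uses.\<close>

lemma finite_dim_coordinates:
  assumes "finite_dim_type TYPE('a::real_normed_vector)"
  obtains B :: "'a::real_normed_vector set" and r :: "'a \<Rightarrow> 'a \<Rightarrow> real"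
  where "finite B" "\<And>b. bounded_linear (r b)" "\<And>w. w = (\<Sum>b\<in>B. r b w *\<^sub>R b)"
proof -
  obtain C :: "'a set" where C: "finite C" "span C = UNIV"
    using assms by (auto simp: finite_dim_type_def)
  obtain B where B: "B \<subseteq> C" "independent B" "C \<subseteq> span B"
    using maximal_independent_subset[of C] by metis
  have finB: "finite B" using B C finite_subset by blast
  have spB: "span B = UNIV" using B C by (metis span_mono span_span top.extremum_uniqueI)
  show ?thesis
  proof
    show "bounded_linear (\<lambda>w. representation B w b)" for b
      by (intro finite_dim_linear_bounded[OF assms] linearI)
        (simp_all add: B spB representation_add representation_scale)
    show "w = (\<Sum>b\<in>B. representation B w b *\<^sub>R b)" for w
      using sum_representation_eq[OF B(2) _ finB order_refl, of w] spB by simp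
  qed (rule finB)
qed

lemma finite_dim_type_real: "finite_dim_type TYPE(real)"
  unfolding finite_dim_type_def by (intro exI[of _ Basis] conjI finite_Basis span_Basis)

lemma finite_dim_type_prod:
  assumes "finite_dim_type TYPE('a::real_normed_vector)" "finite_dim_type TYPE('b::real_normed_vector)"
  shows "finite_dim_type TYPE('a \<times> 'b)"
proof -
  obtain B :: "'a set" and C :: "'b set"
    where B: "finite B" "span B = UNIV" and C: "finite C" "span C = UNIV"
    using assms by (auto simp: finite_dim_type_def)
  let ?D = "(\<lambda>x. (x, 0)) ` B \<union> (\<lambda>y. (0, y)) ` C"
  have l: "linear (\<lambda>x::'a. (x, 0::'b))" "linear (\<lambda>y::'b. (0::'a, y))"
    by (auto intro!: linearI)
  have "(x, 0) \<in> span ?D" for x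
    using linear_span_image[OF l(1), of B] B span_mono[of "(\<lambda>x. (x, 0)) ` B" ?D] by auto
  moreover have "(0, y) \<in> span ?D" for y
    using linear_span_image[OF l(2), of C] C span_mono[of "(\<lambda>y. (0, y)) ` C" ?D] by auto
  ultimately have "(x, y) \<in> span ?D" for x y
    using span_add[of "(x, 0)" ?D "(0, y)"] by simp
  then have "span ?D = UNIV" by auto
  then show ?thesis
    unfolding finite_dim_type_def using B C by (metis finite_UnI finite_imageI)
qed

section \<open>Calculus of maps of class \<open>C\<^sup>k\<close>\<close>

lemma Ck_on_subset: "Ck_on k U f \<Longrightarrow> V \<subseteq> U \<Longrightarrow> Ck_on k V f"
  by (induction k arbitrary: f) (auto intro: continuous_on_subset)

lemma Ck_on_cong:
  assumes "open U" "\<And>x. x \<in> U \<Longrightarrow> f x = g x" "Ck_on k U f"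
  shows "Ck_on k U g"
  using assms(2,3)
proof (induction k arbitrary: f g)
  case 0
  then show ?case by (simp cong: continuous_on_cong)
next
  case (Suc k)
  have der: "(g has_derivative frechet_derivative f (at x)) (at x)" if "x \<in> U" for x
  proof (rule has_derivative_transform_within_open[OF _ assms(1) that Suc.prems(1)])
    show "(f has_derivative frechet_derivative f (at x)) (at x)"
      using Suc.prems(2) that by (simp flip: frechet_derivative_works)
  qed
  have eq: "frechet_derivative f (at x) = frechet_derivative g (at x)" if "x \<in> U" for x
    using der[OF that] by (rule frechet_derivative_at)
  have "Ck_on k U (\<lambda>x. frechet_derivative g (at x) v)" for v
  proof (rule Suc.IH)
    show "Ck_on k U (\<lambda>x. frechet_derivative f (at x) v)" using Suc.prems(2) by simp
  qed (simp add: eq)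
  moreover have "g differentiable (at x)" if "x \<in> U" for x
    using der[OF that] by (auto simp: differentiable_def)
  ultimately show ?case by simp
qed

text \<open>The induction step of the closure properties below: it suffices to know a formula for the derivative
  whose values in fixed directions are \<open>C\<^sup>k\<close>.\<close>

lemma Ck_on_SucI:
  assumes "open U" "\<And>x. x \<in> U \<Longrightarrow> (f has_derivative D x) (at x)"
    and "\<And>v. Ck_on k U (\<lambda>x. D x v)"
  shows "Ck_on (Suc k) U f"
proof -
  have "D x = frechet_derivative f (at x)" if "x \<in> U" for x
    using assms(2)[OF that] by (rule frechet_derivative_at)
  then have "Ck_on k U (\<lambda>x. frechet_derivative f (at x) v)" for v
    using Ck_on_cong[OF assms(1) _ assms(3)[of v]] by auto
  then show ?thesis using assms(2) by (auto simp: differentiable_def)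
qed

lemma Ck_on_SucD: "Ck_on (Suc k) U f \<Longrightarrow> Ck_on k U f"
proof (induction k arbitrary: f)
  case 0
  then show ?case
    by (simp, blast intro: differentiable_imp_continuous_on[unfolded differentiable_on_def] differentiable_at_withinI)
next
  case (Suc k)
  then show ?case by (metis Ck_on.simps(2))
qed

lemma Ck_on_const: "Ck_on k U (\<lambda>_. c)"
  by (induction k arbitrary: c) auto

lemma Ck_on_bounded_linear:
  assumes "bounded_linear L" "open U"
  shows "Ck_on k U L"
proof (cases k)
  case 0
  then show ?thesis using assms by (simp add: linear_continuous_on)
next
  case (Suc j)
  show ?thesis unfolding Suc
    by (rule Ck_on_SucI[OF assms(2)])
      (auto intro: bounded_linear_imp_has_derivative assms Ck_on_const)
qed

lemma Ck_on_linear_compose: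
  assumes L: "bounded_linear L" and U: "open U" and f: "Ck_on k U f"
  shows "Ck_on k U (\<lambda>x. L (f x))"
  using f
proof (induction k arbitrary: f)
  case 0
  then show ?case by (auto intro: bounded_linear.continuous_on[OF L])
next
  case (Suc k)
  show ?case
  proof (rule Ck_on_SucI[OF U])
    show "((\<lambda>x. L (f x)) has_derivative (\<lambda>v. L (frechet_derivative f (at x) v))) (at x)"
      if "x \<in> U" for x
      using Suc.prems that
      by (auto intro!: bounded_linear.has_derivative[OF L] simp: frechet_derivative_works)
  qed (use Suc in auto)
qed

lemma Ck_on_add:
  assumes U: "open U" and "Ck_on k U f" "Ck_on k U g"
  shows "Ck_on k U (\<lambda>x. f x + g x)"
  using assms(2,3)
proof (induction k arbitrary: f g)
  case 0
  then show ?case by (auto intro: continuous_on_add)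
next
  case (Suc k)
  show ?case
  proof (rule Ck_on_SucI[OF U])
    show "((\<lambda>x. f x + g x) has_derivative
        (\<lambda>v. frechet_derivative f (at x) v + frechet_derivative g (at x) v)) (at x)"
      if "x \<in> U" for x
      using Suc.prems that by (auto intro!: has_derivative_add simp: frechet_derivative_works)
  qed (use Suc in auto)
qed

lemma Ck_on_sum:
  assumes U: "open U" and "\<And>i. i \<in> A \<Longrightarrow> Ck_on k U (f i)"
  shows "Ck_on k U (\<lambda>x. \<Sum>i\<in>A. f i x)"
  using assms(2)
  by (induction A rule: infinite_finite_induct) (auto intro!: Ck_on_const Ck_on_add[OF U])

lemma Ck_on_scaleR:
  fixes a :: "'a::real_normed_vector \<Rightarrow> real"
  assumes U: "open U" and "Ck_on k U a" "Ck_on k U f"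
  shows "Ck_on k U (\<lambda>x. a x *\<^sub>R f x)"
  using assms(2,3)
proof (induction k arbitrary: a f)
  case 0
  then show ?case by (auto intro: continuous_on_scaleR)
next
  case (Suc k)
  show ?case
  proof (rule Ck_on_SucI[OF U])
    show "((\<lambda>x. a x *\<^sub>R f x) has_derivative
        (\<lambda>v. a x *\<^sub>R frechet_derivative f (at x) v + frechet_derivative a (at x) v *\<^sub>R f x)) (at x)"
      if "x \<in> U" for x
      using Suc.prems that by (auto intro!: has_derivative_scaleR simp: frechet_derivative_works)
    show "Ck_on k U (\<lambda>x. a x *\<^sub>R frechet_derivative f (at x) v + frechet_derivative a (at x) v *\<^sub>R f x)"
      for v
      using Suc by (intro Ck_on_add[OF U] Suc.IH) (auto intro: Ck_on_SucD simp del: Ck_on.simps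
          simp: Ck_on.simps(2))
  qed
qed

lemma Ck_on_Pair:
  assumes U: "open U" and "Ck_on k U f" "Ck_on k U g"
  shows "Ck_on k U (\<lambda>x. (f x, g x))"
proof -
  have "bounded_linear (\<lambda>y. (y, 0))" "bounded_linear (\<lambda>z. (0, z))"
    by (auto intro!: bounded_linear_Pair bounded_linear_ident bounded_linear_zero)
  from Ck_on_add[OF U Ck_on_linear_compose[OF this(1) U assms(2)]
      Ck_on_linear_compose[OF this(2) U assms(3)]]
  show ?thesis by simp
qed

text \<open>The derivative \<open>D f (g x) (D g x v)\<close> depends on \<open>x\<close> both through the base point and through the
  argument of \<open>D f\<close>, while the class \<open>C\<^sup>k\<close> is defined by derivatives in fixed directions. Expanding the vector
  \<open>D g x v\<close> in coordinates separates the two: the derivative is a sum of real \<open>C\<^sup>k\<close> functions times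
  derivatives of \<open>f\<close> in fixed directions, composed with \<open>g\<close>, to which the induction hypothesis applies.\<close>

lemma Ck_on_compose:
  fixes f :: "'b::real_normed_vector \<Rightarrow> 'c::real_normed_vector"
    and g :: "'a::real_normed_vector \<Rightarrow> 'b"
  assumes fd: "finite_dim_type TYPE('b)" and U: "open U"
    and "Ck_on k V f" "Ck_on k U g" "g ` U \<subseteq> V"
  shows "Ck_on k U (\<lambda>x. f (g x))"
  using assms(3,4,5)
proof (induction k arbitrary: f)
  case 0
  then show ?case by (auto intro: continuous_on_compose2)
next
  case (Suc k)
  obtain B :: "'b set" and r where B: "finite B" and r: "\<And>b. bounded_linear (r b)"
    and rep: "\<And>w. w = (\<Sum>b\<in>B. r b w *\<^sub>R b)"
    by (rule finite_dim_coordinates[OF fd], rule that)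
  let ?D = "\<lambda>x v. \<Sum>b\<in>B. r b (frechet_derivative g (at x) v) *\<^sub>R frechet_derivative f (at (g x)) b"
  show ?case
  proof (rule Ck_on_SucI[OF U])
    fix x assume x: "x \<in> U"
    have f: "(f has_derivative frechet_derivative f (at (g x))) (at (g x))"
      and g: "(g has_derivative frechet_derivative g (at x)) (at x)"
      using Suc.prems x by (auto simp: frechet_derivative_works)
    have "frechet_derivative f (at (g x)) w = (\<Sum>b\<in>B. r b w *\<^sub>R frechet_derivative f (at (g x)) b)"
      for w
    proof -
      note lin = has_derivative_linear[OF f]
      have "frechet_derivative f (at (g x)) w = frechet_derivative f (at (g x)) (\<Sum>b\<in>B. r b w *\<^sub>R b)"
        using rep[of w] by (rule arg_cong)
      also have "\<dots> = (\<Sum>b\<in>B. r b w *\<^sub>R frechet_derivative f (at (g x)) b)"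
        unfolding linear_sum[OF lin] linear_scale[OF lin] ..
      finally show ?thesis .
    qed
    then have "(\<lambda>v. frechet_derivative f (at (g x)) (frechet_derivative g (at x) v)) = ?D x"
      by blast
    with has_derivative_compose[OF g f]
    show "((\<lambda>x. f (g x)) has_derivative ?D x) (at x)" by metis
  next
    fix v
    have "Ck_on k U (\<lambda>x. frechet_derivative f (at (g x)) b)" for b
      using Suc.prems by (intro Suc.IH) (auto intro: Ck_on_SucD simp del: Ck_on.simps
          simp: Ck_on.simps(2))
    moreover have "Ck_on k U (\<lambda>x. r b (frechet_derivative g (at x) v))" for b
      using Suc.prems by (intro Ck_on_linear_compose[OF r U]) auto
    ultimately show "Ck_on k U (\<lambda>x. ?D x v)"
      by (intro Ck_on_sum[OF U] Ck_on_scaleR[OF U])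
  qed
qed

lemma Ck_on_frechet_derivative:
  fixes F :: "'a::real_normed_vector \<Rightarrow> 'b::real_normed_vector"
  assumes "Ck_on (Suc k) U F"
  shows "Ck_on k U (\<lambda>x. frechet_derivative F (at x) v)"
  using assms by simp

section \<open>Germs of smooth maps\<close>

definition smooth_at ::
  "'a::real_normed_vector set \<Rightarrow> ('a \<Rightarrow> 'b::real_normed_vector) \<Rightarrow> 'a \<Rightarrow> bool" where
  "smooth_at S f x \<longleftrightarrow>
     (\<exists>U F. open U \<and> x \<in> U \<and> (\<forall>k. Ck_on k U F) \<and> (\<forall>y\<in>S \<inter> U. F y = f y))"

lemma smooth_on_iff_smooth_at: "smooth_on S f \<longleftrightarrow> (\<forall>x\<in>S. smooth_at S f x)"
  by (simp add: smooth_on_def smooth_at_def)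

text \<open>Germs only depend on the set and on the function near the point. This lemma is used whenever two
  coordinate expressions agree only on a neighbourhood.\<close>

lemma smooth_at_transfer:
  assumes "smooth_at S f x" "open W" "x \<in> W" "\<And>y. y \<in> T \<Longrightarrow> y \<in> W \<Longrightarrow> y \<in> S"
    and "\<And>y. y \<in> T \<Longrightarrow> y \<in> W \<Longrightarrow> f y = g y"
  shows "smooth_at T g x"
proof -
  obtain U F where U: "open U" "x \<in> U" "\<And>k. Ck_on k U F" "\<And>y. y \<in> S \<inter> U \<Longrightarrow> F y = f y"
    using assms(1) by (auto simp: smooth_at_def)
  show ?thesis
    unfolding smooth_at_def
  proof (intro exI[of _ "U \<inter> W"] exI[of _ F] conjI allI ballI)
    show "Ck_on k (U \<inter> W) F" for k using U(3) by (rule Ck_on_subset) simp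
  qed (use U assms in auto)
qed

lemma smooth_at_subset: "smooth_at S f x \<Longrightarrow> T \<subseteq> S \<Longrightarrow> smooth_at T f x"
  by (rule smooth_at_transfer[of S f x UNIV]) auto

lemma smooth_at_Ck: "open U \<Longrightarrow> x \<in> U \<Longrightarrow> (\<And>k. Ck_on k U f) \<Longrightarrow> smooth_at S f x"
  unfolding smooth_at_def by blast

lemma smooth_at_const: "smooth_at S (\<lambda>_. c) x"
  by (rule smooth_at_Ck[of UNIV]) (auto intro: Ck_on_const)

lemma smooth_at_bounded_linear: "bounded_linear L \<Longrightarrow> smooth_at S L x"
  by (rule smooth_at_Ck[of UNIV]) (auto intro: Ck_on_bounded_linear)

lemma smooth_at_linear_compose:
  assumes L: "bounded_linear L" and f: "smooth_at S f x"
  shows "smooth_at S (\<lambda>y. L (f y)) x"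
proof -
  obtain U F where U: "open U" "x \<in> U" "\<And>k. Ck_on k U F" "\<And>y. y \<in> S \<inter> U \<Longrightarrow> F y = f y"
    using f by (auto simp: smooth_at_def)
  show ?thesis
    unfolding smooth_at_def
    by (intro exI[of _ U] exI[of _ "\<lambda>y. L (F y)"] conjI allI ballI)
      (use U in \<open>auto intro: Ck_on_linear_compose[OF L]\<close>)
qed

lemma smooth_at_Pair:
  assumes "smooth_at S f x" "smooth_at S g x"
  shows "smooth_at S (\<lambda>y. (f y, g y)) x"
proof -
  obtain U F where U: "open U" "x \<in> U" "\<And>k. Ck_on k U F" "\<And>y. y \<in> S \<inter> U \<Longrightarrow> F y = f y"
    using assms(1) by (auto simp: smooth_at_def)
  obtain V G where V: "open V" "x \<in> V" "\<And>k. Ck_on k V G" "\<And>y. y \<in> S \<inter> V \<Longrightarrow> G y = g y"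
    using assms(2) by (auto simp: smooth_at_def)
  have "Ck_on k (U \<inter> V) (\<lambda>y. (F y, G y))" for k
    using U V by (intro Ck_on_Pair open_Int Ck_on_subset[OF U(3)] Ck_on_subset[OF V(3)]) auto
  then show ?thesis
    unfolding smooth_at_def
    by (intro exI[of _ "U \<inter> V"] exI[of _ "\<lambda>y. (F y, G y)"]) (use U V in auto)
qed

lemma smooth_at_compose:
  fixes g :: "'a::real_normed_vector \<Rightarrow> 'b::real_normed_vector"
  assumes fd: "finite_dim_type TYPE('b)"
    and "smooth_at S g x" "x \<in> S" "smooth_at T f (g x)" "\<And>y. y \<in> S \<Longrightarrow> g y \<in> T"
  shows "smooth_at S (\<lambda>y. f (g y)) x"
proof -
  obtain U G where U: "open U" "x \<in> U" "\<And>k. Ck_on k U G" "\<And>y. y \<in> S \<inter> U \<Longrightarrow> G y = g y"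
    using assms(2) by (auto simp: smooth_at_def)
  obtain V F where V: "open V" "g x \<in> V" "\<And>k. Ck_on k V F" "\<And>y. y \<in> T \<inter> V \<Longrightarrow> F y = f y"
    using assms(4) by (auto simp: smooth_at_def)
  let ?W = "U \<inter> G -` V"
  have "open ?W"
    using U(1) U(3)[of 0] V(1) by (simp add: continuous_open_preimage)
  moreover have "Ck_on k ?W (\<lambda>y. F (G y))" for k
    using \<open>open ?W\<close> by (intro Ck_on_compose[OF fd _ V(3)] Ck_on_subset[OF U(3)]) auto
  moreover have "x \<in> ?W" using U V assms(3) by auto
  ultimately show ?thesis
    unfolding smooth_at_def
    by (intro exI[of _ ?W] exI[of _ "\<lambda>y. F (G y)"]) (use U V assms(5) in auto)
qed

lemma smooth_at_nbhd:
  assumes "smooth_at S g x" "x \<in> S" "open V" "g x \<in> V"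
  obtains W where "open W" "x \<in> W" "\<And>y. y \<in> S \<Longrightarrow> y \<in> W \<Longrightarrow> g y \<in> V"
proof -
  obtain U G where U: "open U" "x \<in> U" "\<And>k. Ck_on k U G" "\<And>y. y \<in> S \<inter> U \<Longrightarrow> G y = g y"
    using assms(1) by (auto simp: smooth_at_def)
  show ?thesis
  proof
    show "open (U \<inter> G -` V)"
      using U(1) U(3)[of 0] assms(3) by (simp add: continuous_open_preimage)
    show "x \<in> U \<inter> G -` V" using U assms by auto
    show "g y \<in> V" if "y \<in> S" "y \<in> U \<inter> G -` V" for y
      using that U(4)[of y] by auto
  qed
qed

lemma smooth_at_differentiable_within:
  assumes "smooth_at S f x" "x \<in> S"
  shows "f differentiable (at x within S)"
proof -
  obtain U F where U: "open U" "x \<in> U" "\<And>k. Ck_on k U F" "\<And>y. y \<in> S \<inter> U \<Longrightarrow> F y = f y"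
    using assms(1) by (auto simp: smooth_at_def)
  obtain d where d: "d > 0" "ball x d \<subseteq> U" using U open_contains_ball by blast
  have "F differentiable (at x)" using U(2) U(3)[of "Suc 0"] by simp
  then have "F differentiable (at x within S)" by (rule differentiable_at_withinI)
  then show ?thesis
    using d(1) assms(2)
  proof (rule differentiable_transform_within)
    show "F y = f y" if "y \<in> S" "dist y x < d" for y
      using that U(4)[of y] d(2) by (auto simp: dist_commute)
  qed
qed

lemma smooth_at_differentiable:
  assumes "smooth_at S f x" "open S" "x \<in> S"
  shows "f differentiable (at x)"
  using smooth_at_differentiable_within[OF assms(1,3)] assms(2,3) at_within_open by metis

text \<open>A smooth extension \<open>F\<close> of \<open>f\<close> to a neighbourhood has a partial derivative in the first variable, which
  is smooth. It agrees with the derivative of \<open>f\<close> along \<open>I\<close>, which may be one-sided, because derivatives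
  within \<open>I\<close> are unique at points that are not isolated. The time \<open>\<tau> y\<close> depends on the
  parameter so as to include the case of a time that is itself the parameter.\<close>

lemma smooth_at_partial_derivative:
  fixes f :: "real \<times> 'a::real_normed_vector \<Rightarrow> 'b::real_normed_vector"
  assumes fd: "finite_dim_type TYPE('a)"
    and f: "smooth_at (I \<times> S) f (\<tau> y\<^sub>0, y\<^sub>0)" and \<tau>: "smooth_at S \<tau> y\<^sub>0" and y0: "y\<^sub>0 \<in> S"
    and \<tau>I: "\<And>y. y \<in> S \<Longrightarrow> \<tau> y \<in> I" and I: "\<And>t. t \<in> I \<Longrightarrow> at t within I \<noteq> bot"
  shows "smooth_at S (\<lambda>y. vector_derivative (\<lambda>x. f (x, y)) (at (\<tau> y) within I)) y\<^sub>0"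
proof -
  obtain U F where U: "open U" "(\<tau> y\<^sub>0, y\<^sub>0) \<in> U" "\<And>k. Ck_on k U F"
    "\<And>p. p \<in> (I \<times> S) \<inter> U \<Longrightarrow> F p = f p"
    using f by (auto simp: smooth_at_def)
  have pair: "smooth_at S (\<lambda>y. (\<tau> y, y)) y\<^sub>0"
    by (intro smooth_at_Pair \<tau> smooth_at_bounded_linear bounded_linear_ident)
  obtain W where W: "open W" "y\<^sub>0 \<in> W" "\<And>y. y \<in> S \<Longrightarrow> y \<in> W \<Longrightarrow> (\<tau> y, y) \<in> U"
    by (rule smooth_at_nbhd[OF pair y0 U(1,2)]) blast
  have eq: "frechet_derivative F (at (\<tau> y, y)) (1, 0)
      = vector_derivative (\<lambda>x. f (x, y)) (at (\<tau> y) within I)"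
    if y: "y \<in> S" "y \<in> W" for y
  proof -
    let ?F' = "frechet_derivative F (at (\<tau> y, y))"
    have F': "(F has_derivative ?F') (at (\<tau> y, y))"
      using U(3)[of "Suc 0"] W(3)[OF y] by (simp flip: frechet_derivative_works)
    have "((\<lambda>x. (x, y)) has_vector_derivative (1, 0)) (at (\<tau> y) within I)"
      by (auto intro!: derivative_eq_intros)
    then have "((\<lambda>x. (x, y)) has_derivative (\<lambda>h. h *\<^sub>R (1, 0))) (at (\<tau> y) within I)"
      by (simp add: has_vector_derivative_def)
    from has_derivative_compose[OF this F']
    have F_vec: "((\<lambda>x. F (x, y)) has_vector_derivative ?F' (1, 0)) (at (\<tau> y) within I)"
      by (simp only: has_vector_derivative_def linear_scale[OF has_derivative_linear[OF F']])
    obtain d where d: "d > 0" "\<And>x. dist x (\<tau> y) < d \<Longrightarrow> (x, y) \<in> U"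
    proof -
      have "open ((\<lambda>x. (x, y)) -` U)" by (intro open_vimage U(1) continuous_intros)
      then show ?thesis
        using that W(3)[OF y] by (auto simp: open_dist)
    qed
    from F_vec d(1) \<tau>I[OF y(1)]
    have "((\<lambda>x. f (x, y)) has_vector_derivative ?F' (1, 0)) (at (\<tau> y) within I)"
      by (rule has_vector_derivative_transform_within) (use y U(4) d(2) in auto)
    then show ?thesis
      using vector_derivative_within[OF I[OF \<tau>I[OF y(1)]]] by metis
  qed
  have "smooth_at U (\<lambda>p. frechet_derivative F (at p) (1, 0)) (\<tau> y\<^sub>0, y\<^sub>0)"
    by (rule smooth_at_Ck[OF U(1,2)]) (use U(3) in \<open>auto intro: Ck_on_frechet_derivative\<close>)
  from smooth_at_compose[OF finite_dim_type_prod[OF finite_dim_type_real fd]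
      smooth_at_subset[OF pair] _ this, of "S \<inter> W"]
  have "smooth_at (S \<inter> W) (\<lambda>y. frechet_derivative F (at (\<tau> y, y)) (1, 0)) y\<^sub>0"
    using W y0 by blast
  then show ?thesis
    by (rule smooth_at_transfer[OF _ W(1,2)]) (use eq in auto)
qed

section \<open>Manifolds and smooth maps\<close>

context smooth_manifold
begin

lemma finite_dim_model: "finite_dim_type TYPE('e)"
  using finite_dim by (simp add: finite_dim_type_def)

lemma chart_subset: "c \<in> atlas M \<Longrightarrow> fst c \<subseteq> topspace (mtop M)"
  using chart_open openin_subset by blast

lemma chart_inj: "c \<in> atlas M \<Longrightarrow> inj_on (snd c) (fst c)"
  using homeomorphic_imp_injective_map[OF chart_homeomorphic, of c] chart_subset[of c]
  by (simp add: inf.absorb2)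

lemma chart_inv_left [simp]: "c \<in> atlas M \<Longrightarrow> x \<in> fst c \<Longrightarrow> chart_inv c (snd c x) = x"
  by (simp add: chart_inv_def chart_inj)

lemma chart_image_open:
  assumes "c \<in> atlas M" "openin (mtop M) W"
  shows "open (snd c ` (W \<inter> fst c))"
proof -
  have "openin (subtopology (mtop M) (fst c)) (W \<inter> fst c)"
    using assms(2) by (rule openin_subtopology_Int)
  then have "openin (top_of_set (snd c ` fst c)) (snd c ` (W \<inter> fst c))"
    using homeomorphic_imp_open_map[OF chart_homeomorphic[OF assms(1)]] by (simp add: open_map_def)
  then show ?thesis
    using chart_open[OF assms(1)] openin_open_trans by blast
qed

lemma chart_continuous:
  assumes "c \<in> atlas M" "open V"
  shows "openin (mtop M) {x \<in> fst c. snd c x \<in> V}"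
proof -
  have "continuous_map (subtopology (mtop M) (fst c)) euclidean (snd c)"
    using homeomorphic_imp_continuous_map[OF chart_homeomorphic[OF assms(1)]]
    by (simp add: continuous_map_in_subtopology)
  then have "openin (subtopology (mtop M) (fst c))
      {x \<in> topspace (subtopology (mtop M) (fst c)). snd c x \<in> V}"
    using assms(2) openin_continuous_map_preimage by fastforce
  moreover have "{x \<in> topspace (subtopology (mtop M) (fst c)). snd c x \<in> V} = {x \<in> fst c. snd c x \<in> V}"
    using chart_subset[OF assms(1)] by auto
  ultimately show ?thesis
    using chart_open[OF assms(1)] openin_trans_full[of "mtop M" "fst c"] by fastforce
qed

lemma chart_transition_smooth_at:
  "c \<in> atlas M \<Longrightarrow> d \<in> atlas M \<Longrightarrow> p \<in> fst c \<inter> fst d \<Longrightarrow>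
    smooth_at (snd c ` (fst c \<inter> fst d)) (snd d \<circ> chart_inv c) (snd c p)"
  using charts_compatible unfolding smooth_on_iff_smooth_at by blast

lemma charts_at_nonempty: "p \<in> topspace (mtop M) \<Longrightarrow> \<exists>c. c \<in> charts_at M p"
  unfolding charts_at_def atlas_covers[symmetric] by blast

lemma some_chart_at: "p \<in> topspace (mtop M) \<Longrightarrow> (SOME c. c \<in> charts_at M p) \<in> charts_at M p"
  using charts_at_nonempty by (rule someI_ex)

end

lemma charts_atD: "c \<in> charts_at M p \<Longrightarrow> c \<in> atlas M \<and> p \<in> fst c"
  by (simp add: charts_at_def)

lemma smooth_map_on_subset: "smooth_map_on M S N f \<Longrightarrow> S \<subseteq> topspace (mtop M)"
  by (simp add: smooth_map_on_def)

lemma smooth_map_on_image: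
  "smooth_map_on M S N f \<Longrightarrow> x \<in> S \<Longrightarrow> f x \<in> topspace (mtop N)"
  unfolding smooth_map_on_def continuous_map_def by (auto simp: Pi_iff)

text \<open>Continuity, expressed in a chart of the source. It is what makes coordinate expressions of a
  composite meaningful near a point.\<close>

lemma smooth_map_on_chart_nbhd:
  assumes M: "smooth_manifold M" and N: "smooth_manifold N" and f: "smooth_map_on M S N f"
    and p: "p \<in> S" and c: "c \<in> charts_at M p" and V: "openin (mtop N) V" "f p \<in> V"
  obtains W where "open W" "snd c p \<in> W"
    "\<And>x. x \<in> S \<Longrightarrow> x \<in> fst c \<Longrightarrow> snd c x \<in> W \<Longrightarrow> f x \<in> V"
proof -
  interpret M: smooth_manifold M by fact
  have Stop: "S \<subseteq> topspace (mtop M)" using f by (rule smooth_map_on_subset)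
  have "openin (subtopology (mtop M) S) {x \<in> topspace (subtopology (mtop M) S). f x \<in> V}"
    using f V by (intro openin_continuous_map_preimage) (auto simp: smooth_map_on_def)
  then obtain T where T: "openin (mtop M) T" "{x \<in> S. f x \<in> V} = T \<inter> S"
    using Stop by (auto simp: openin_subtopology inf.absorb2)
  show ?thesis
  proof
    show "open (snd c ` (T \<inter> fst c))" using c T by (auto intro: M.chart_image_open dest: charts_atD)
    have "p \<in> T" using p V(2) T(2) by blast
    then show "snd c p \<in> snd c ` (T \<inter> fst c)" using c by (auto dest: charts_atD)
    fix x assume x: "x \<in> S" "x \<in> fst c" "snd c x \<in> snd c ` (T \<inter> fst c)"
    then obtain x' where "x' \<in> T \<inter> fst c" "snd c x = snd c x'" by auto
    then have "x \<in> T" using M.chart_inj c x by (metis Int_iff charts_atD inj_onD)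
    then show "f x \<in> V" using T x by blast
  qed
qed

text \<open>The domain of the coordinate expression in the definition of smoothness, on which \<open>f\<close> takes values in the
  domain of \<open>d\<close>, may be replaced by all of \<open>S\<close> in the chart: near \<open>p\<close> they agree.\<close>

lemma smooth_map_on_germ:
  assumes M: "smooth_manifold M" and N: "smooth_manifold N" and f: "smooth_map_on M S N f"
    and p: "p \<in> S" and c: "c \<in> charts_at M p" and d: "d \<in> charts_at N (f p)"
  shows "smooth_at (snd c ` (S \<inter> fst c)) (snd d \<circ> f \<circ> chart_inv c) (snd c p)"
proof -
  have d': "openin (mtop N) (fst d)" "f p \<in> fst d"
    using d smooth_manifold.chart_open[OF N] by (auto simp: charts_at_def)
  obtain W where W: "open W" "snd c p \<in> W"
    "\<And>x. x \<in> S \<Longrightarrow> x \<in> fst c \<Longrightarrow> snd c x \<in> W \<Longrightarrow> f x \<in> fst d"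
    by (rule smooth_map_on_chart_nbhd[OF M N f p c d']) blast
  have "smooth_on (snd c ` {x \<in> S \<inter> fst c. f x \<in> fst d}) (snd d \<circ> f \<circ> chart_inv c)"
    using f c d by (auto simp: smooth_map_on_def charts_at_def)
  then have "smooth_at (snd c ` {x \<in> S \<inter> fst c. f x \<in> fst d}) (snd d \<circ> f \<circ> chart_inv c) (snd c p)"
    using p c d by (auto simp: smooth_on_iff_smooth_at charts_at_def)
  then show ?thesis
    by (rule smooth_at_transfer[OF _ W(1,2)]) (use W(3) in auto)
qed

lemma smooth_map_onI:
  assumes "S \<subseteq> topspace (mtop M)" "continuous_map (subtopology (mtop M) S) (mtop N) f"
    and "\<And>p c d. p \<in> S \<Longrightarrow> c \<in> charts_at M p \<Longrightarrow> d \<in> charts_at N (f p) \<Longrightarrow>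
      smooth_at (snd c ` (S \<inter> fst c)) (snd d \<circ> f \<circ> chart_inv c) (snd c p)"
  shows "smooth_map_on M S N f"
  unfolding smooth_map_on_def smooth_on_iff_smooth_at
proof (intro conjI ballI assms(1,2))
  fix c d y assume c: "c \<in> atlas M" and d: "d \<in> atlas N"
    and "y \<in> snd c ` {x \<in> S \<inter> fst c. f x \<in> fst d}"
  then obtain x where x: "x \<in> S" "x \<in> fst c" "f x \<in> fst d" "y = snd c x" by auto
  show "smooth_at (snd c ` {x \<in> S \<inter> fst c. f x \<in> fst d}) (snd d \<circ> f \<circ> chart_inv c) y"
    unfolding x(4) using x c d
    by (intro smooth_at_subset[OF assms(3)]) (auto simp: charts_at_def)
qed

lemma smooth_map_on_cong:
  assumes "smooth_manifold M" "smooth_map_on M S N f" "\<And>x. x \<in> S \<Longrightarrow> f x = g x"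
  shows "smooth_map_on M S N g"
proof -
  interpret M: smooth_manifold M by fact
  have "continuous_map (subtopology (mtop M) S) (mtop N) g"
    using assms(2,3) by (auto simp: smooth_map_on_def intro: continuous_map_eq)
  moreover have "smooth_at (snd c ` {x \<in> S \<inter> fst c. g x \<in> fst d}) (snd d \<circ> g \<circ> chart_inv c) y"
    if "c \<in> atlas M" "d \<in> atlas N" "y \<in> snd c ` {x \<in> S \<inter> fst c. g x \<in> fst d}" for c d y
  proof -
    have eq: "{x \<in> S \<inter> fst c. g x \<in> fst d} = {x \<in> S \<inter> fst c. f x \<in> fst d}"
      using assms(3) by auto
    show ?thesis
      by (rule smooth_at_transfer[of "snd c ` {x \<in> S \<inter> fst c. f x \<in> fst d}" "snd d \<circ> f \<circ> chart_inv c" y UNIV])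
        (use assms that eq in \<open>auto simp: smooth_map_on_def smooth_on_iff_smooth_at\<close>)
  qed
  ultimately show ?thesis
    using assms(2) by (auto simp: smooth_map_on_def smooth_on_iff_smooth_at)
qed

lemma smooth_map_on_compose:
  assumes M: "smooth_manifold M" and N: "smooth_manifold N" and P: "smooth_manifold P"
    and f: "smooth_map_on M S N f" and g: "smooth_map_on N T P g"
    and ST: "\<And>x. x \<in> S \<Longrightarrow> f x \<in> T"
  shows "smooth_map_on M S P (\<lambda>x. g (f x))"
proof (rule smooth_map_onI)
  interpret M: smooth_manifold M by fact
  interpret N: smooth_manifold N by fact
  show "S \<subseteq> topspace (mtop M)" using f by (rule smooth_map_on_subset)
  have "continuous_map (subtopology (mtop M) S) (subtopology (mtop N) T) f"
    using f ST by (auto simp: smooth_map_on_def continuous_map_in_subtopology)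
  then have "continuous_map (subtopology (mtop M) S) (mtop P) (g \<circ> f)"
    using g by (intro continuous_map_compose) (auto simp: smooth_map_on_def)
  then show "continuous_map (subtopology (mtop M) S) (mtop P) (\<lambda>x. g (f x))"
    by (simp add: comp_def)
  fix p c e assume p: "p \<in> S" and c: "c \<in> charts_at M p" and e: "e \<in> charts_at P (g (f p))"
  obtain d where d: "d \<in> charts_at N (f p)"
    using N.charts_at_nonempty smooth_map_on_image[OF f p] by blast
  have d': "openin (mtop N) (fst d)" "f p \<in> fst d"
    using d N.chart_open by (auto simp: charts_at_def)
  obtain W where W: "open W" "snd c p \<in> W"
    "\<And>x. x \<in> S \<Longrightarrow> x \<in> fst c \<Longrightarrow> snd c x \<in> W \<Longrightarrow> f x \<in> fst d"
    by (rule smooth_map_on_chart_nbhd[OF M N f p c d']) blast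
  note cd = charts_atD[OF c] charts_atD[OF d]
  let ?S = "snd c ` (S \<inter> fst c)"
  have "smooth_at (?S \<inter> W) (\<lambda>y. (snd e \<circ> g \<circ> chart_inv d) ((snd d \<circ> f \<circ> chart_inv c) y)) (snd c p)"
  proof (rule smooth_at_compose[OF N.finite_dim_model])
    show "smooth_at (?S \<inter> W) (snd d \<circ> f \<circ> chart_inv c) (snd c p)"
      by (rule smooth_at_subset[OF smooth_map_on_germ[OF M N f p c d]]) simp
    show "snd c p \<in> ?S \<inter> W" using p cd W by auto
    show "smooth_at (snd d ` (T \<inter> fst d)) (snd e \<circ> g \<circ> chart_inv d)
        ((snd d \<circ> f \<circ> chart_inv c) (snd c p))"
      using smooth_map_on_germ[OF N P g ST[OF p] d e] cd by simp
    show "(snd d \<circ> f \<circ> chart_inv c) y \<in> snd d ` (T \<inter> fst d)" if "y \<in> ?S \<inter> W" for y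
      using that W(3) ST cd by auto
  qed
  then show "smooth_at ?S (snd e \<circ> (\<lambda>x. g (f x)) \<circ> chart_inv c) (snd c p)"
    by (rule smooth_at_transfer[OF _ W(1,2)]) (use W(3) cd in auto)
qed

lemma smooth_map_on_const:
  assumes "S \<subseteq> topspace (mtop M)" "q \<in> topspace (mtop N)"
  shows "smooth_map_on M S N (\<lambda>_. q)"
  using assms by (intro smooth_map_onI) (auto simp: comp_def intro: smooth_at_const)

lemma smooth_map_on_id:
  assumes M: "smooth_manifold M" and S: "S \<subseteq> topspace (mtop M)"
  shows "smooth_map_on M S M (\<lambda>x. x)"
proof -
  interpret M: smooth_manifold M by fact
  have "smooth_on (snd c ` {x \<in> S \<inter> fst c. x \<in> fst d}) (snd d \<circ> chart_inv c)"
    if "c \<in> atlas M" "d \<in> atlas M" for c d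
  proof -
    have "snd c ` {x \<in> S \<inter> fst c. x \<in> fst d} \<subseteq> snd c ` (fst c \<inter> fst d)" by auto
    then show ?thesis
      using M.charts_compatible[OF that]
      by (meson smooth_at_subset smooth_on_iff_smooth_at subset_iff)
  qed
  then show ?thesis
    using S by (auto simp: smooth_map_on_def comp_def continuous_map_from_subtopology)
qed

section \<open>The real line and products\<close>

lemma chart_inv_real [simp]: "chart_inv (UNIV, id) = id"
  by (auto simp: chart_inv_def fun_eq_iff intro: inv_into_f_eq)

lemma charts_at_real [simp]: "charts_at real_manifold t = {(UNIV, id)}"
  by (auto simp: charts_at_def real_manifold_def)

lemma topspace_real_manifold [simp]: "topspace (mtop real_manifold) = UNIV"
  by (simp add: real_manifold_def)

lemma smooth_manifold_real: "smooth_manifold real_manifold"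
proof
  show "\<exists>B::real set. finite B \<and> span B = UNIV"
    using finite_dim_type_real by (simp add: finite_dim_type_def)
  show "second_countable (mtop real_manifold)"
  proof -
    obtain \<B> :: "real set set" where B: "countable \<B>" "\<And>V. V \<in> \<B> \<Longrightarrow> open V"
      "\<And>U. open U \<Longrightarrow> \<exists>\<U>. \<U> \<subseteq> \<B> \<and> U = \<Union>\<U>"
      by (rule univ_second_countable) blast
    have "\<exists>V\<in>\<B>. x \<in> V \<and> V \<subseteq> U" if "open U" "x \<in> U" for U x
      using B(3)[OF that(1)] that(2) by blast
    then show ?thesis
      using B(1,2) unfolding second_countable_def real_manifold_def by auto
  qed
  fix c d :: "real set \<times> (real \<Rightarrow> real)"
  assume "c \<in> atlas real_manifold" "d \<in> atlas real_manifold"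
  then have "snd d \<circ> chart_inv c = (\<lambda>x. x)" by (auto simp: real_manifold_def)
  then show "smooth_on (snd c ` (fst c \<inter> fst d)) (snd d \<circ> chart_inv c)"
    by (auto simp: smooth_on_iff_smooth_at intro: smooth_at_bounded_linear bounded_linear_ident)
qed (auto simp: real_manifold_def Hausdorff_space_euclidean homeomorphic_map_id[unfolded id_def] id_def)

definition prod_chart :: "('m, 'e) chart \<Rightarrow> ('n, 'f) chart \<Rightarrow> ('m \<times> 'n, 'e \<times> 'f) chart" where
  "prod_chart c d = (fst c \<times> fst d, map_prod (snd c) (snd d))"

lemma prod_chart_simps [simp]:
  "fst (prod_chart c d) = fst c \<times> fst d" "snd (prod_chart c d) = map_prod (snd c) (snd d)"
  by (simp_all add: prod_chart_def)

lemma mtop_prod_manifold [simp]: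
  "mtop (prod_manifold M N) = prod_topology (mtop M) (mtop N)"
  by (simp add: prod_manifold_def)

lemma atlas_prod_manifold:
  "atlas (prod_manifold M N) = {prod_chart c d | c d. c \<in> atlas M \<and> d \<in> atlas N}"
  by (simp add: prod_manifold_def prod_chart_def)

lemma charts_at_prod_manifold:
  "charts_at (prod_manifold M N) (p, q) =
     {prod_chart c d | c d. c \<in> charts_at M p \<and> d \<in> charts_at N q}"
proof (intro equalityI subsetI)
  fix k assume "k \<in> charts_at (prod_manifold M N) (p, q)"
  then obtain c d where cd: "k = prod_chart c d" "c \<in> atlas M" "d \<in> atlas N" "(p, q) \<in> fst (prod_chart c d)"
    unfolding charts_at_def atlas_prod_manifold by blast
  then have "c \<in> charts_at M p" "d \<in> charts_at N q" by (simp_all add: charts_at_def)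
  with cd(1) show "k \<in> {prod_chart c d | c d. c \<in> charts_at M p \<and> d \<in> charts_at N q}" by blast
next
  fix k assume "k \<in> {prod_chart c d | c d. c \<in> charts_at M p \<and> d \<in> charts_at N q}"
  then obtain c d where cd: "k = prod_chart c d" "c \<in> charts_at M p" "d \<in> charts_at N q" by blast
  then have "(p, q) \<in> fst (prod_chart c d)" by (simp add: charts_at_def)
  with cd show "k \<in> charts_at (prod_manifold M N) (p, q)"
    unfolding charts_at_def atlas_prod_manifold by blast
qed

lemma chart_inv_prod_chart:
  assumes "smooth_manifold M" "smooth_manifold N" "c \<in> atlas M" "d \<in> atlas N"
    and "x \<in> fst c" "y \<in> fst d"
  shows "chart_inv (prod_chart c d) (snd c x, snd d y) = (x, y)"
proof -
  have "inj_on (snd (prod_chart c d)) (fst (prod_chart c d))"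
    using assms smooth_manifold.chart_inj[of M c] smooth_manifold.chart_inj[of N d]
    by (simp add: map_prod_inj_on)
  from inv_into_f_f[OF this, of "(x, y)"] show ?thesis
    using assms by (simp add: chart_inv_def)
qed

lemma smooth_manifold_prod:
  fixes M :: "('m, 'e::real_normed_vector) manifold" and N :: "('n, 'f::real_normed_vector) manifold"
  assumes M: "smooth_manifold M" and N: "smooth_manifold N"
  shows "smooth_manifold (prod_manifold M N)"
proof
  interpret M: smooth_manifold M by fact
  interpret N: smooth_manifold N by fact
  show "\<exists>B::('e \<times> 'f) set. finite B \<and> span B = UNIV"
    using finite_dim_type_prod[OF M.finite_dim_model N.finite_dim_model]
    by (simp add: finite_dim_type_def)
  show "Hausdorff_space (mtop (prod_manifold M N))"
    by (simp add: Hausdorff_space_prod_topology M.Hausdorff N.Hausdorff)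
  show "second_countable (mtop (prod_manifold M N))"
  proof -
    obtain \<B> where B: "countable \<B> \<and> (\<forall>V\<in>\<B>. openin (mtop M) V) \<and>
        (\<forall>U x. openin (mtop M) U \<and> x \<in> U \<longrightarrow> (\<exists>V\<in>\<B>. x \<in> V \<and> V \<subseteq> U))"
      using M.second_countable unfolding second_countable_def ..
    obtain \<C> where C: "countable \<C> \<and> (\<forall>V\<in>\<C>. openin (mtop N) V) \<and>
        (\<forall>U x. openin (mtop N) U \<and> x \<in> U \<longrightarrow> (\<exists>V\<in>\<C>. x \<in> V \<and> V \<subseteq> U))"
      using N.second_countable unfolding second_countable_def ..
    let ?D = "(\<lambda>(U, V). U \<times> V) ` (\<B> \<times> \<C>)"
    have "\<exists>V\<in>?D. x \<in> V \<and> V \<subseteq> W"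
      if W: "openin (prod_topology (mtop M) (mtop N)) W" "x \<in> W" for W x
    proof -
      have "(fst x, snd x) \<in> W" using W(2) by simp
      then obtain U V where UV: "openin (mtop M) U" "openin (mtop N) V" "fst x \<in> U" "snd x \<in> V"
        "U \<times> V \<subseteq> W"
        using W(1)[unfolded openin_prod_topology_alt, rule_format, of "fst x" "snd x"] by auto
      obtain U' where U': "U' \<in> \<B>" "fst x \<in> U'" "U' \<subseteq> U" using B UV(1,3) by meson
      obtain V' where V': "V' \<in> \<C>" "snd x \<in> V'" "V' \<subseteq> V" using C UV(2,4) by meson
      have "U' \<times> V' \<in> ?D" using U' V' by auto
      moreover have "x \<in> U' \<times> V'" using U' V' by (simp add: mem_Times_iff)
      moreover have "U' \<times> V' \<subseteq> W" using U' V' UV(5) by blast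
      ultimately show ?thesis by blast
    qed
    moreover have "countable ?D" using B C by simp
    moreover have "openin (prod_topology (mtop M) (mtop N)) V" if "V \<in> ?D" for V
      using that B C by (auto simp: openin_prod_Times_iff)
    ultimately show ?thesis
      unfolding second_countable_def mtop_prod_manifold by meson
  qed
  show "(\<Union>c\<in>atlas (prod_manifold M N). fst c) = topspace (mtop (prod_manifold M N))"
  proof -
    have "(\<Union>c\<in>atlas (prod_manifold M N). fst c) = (\<Union>c\<in>atlas M. fst c) \<times> (\<Union>d\<in>atlas N. fst d)"
    proof (intro equalityI subsetI)
      fix p assume "p \<in> (\<Union>c\<in>atlas M. fst c) \<times> (\<Union>d\<in>atlas N. fst d)"
      then obtain c d where "c \<in> atlas M" "d \<in> atlas N" "p \<in> fst (prod_chart c d)" by auto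
      then show "p \<in> (\<Union>c\<in>atlas (prod_manifold M N). fst c)"
        unfolding atlas_prod_manifold by blast
    next
      fix p assume "p \<in> (\<Union>c\<in>atlas (prod_manifold M N). fst c)"
      then obtain c d where cd: "c \<in> atlas M" "d \<in> atlas N" "p \<in> fst (prod_chart c d)"
        unfolding atlas_prod_manifold by blast
      then have "fst p \<in> fst c" "snd p \<in> fst d" by auto
      with cd(1,2) show "p \<in> (\<Union>c\<in>atlas M. fst c) \<times> (\<Union>d\<in>atlas N. fst d)"
        unfolding mem_Times_iff by blast
    qed
    then show ?thesis by (simp add: M.atlas_covers N.atlas_covers)
  qed
  fix c assume "c \<in> atlas (prod_manifold M N)"
  then obtain c1 c2 where c: "c = prod_chart c1 c2" "c1 \<in> atlas M" "c2 \<in> atlas N"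
    by (auto simp: atlas_prod_manifold)
  have img: "snd c ` fst c = (snd c1 ` fst c1) \<times> (snd c2 ` fst c2)"
    by (auto simp: c image_iff)
  show "openin (mtop (prod_manifold M N)) (fst c) \<and> open (snd c ` fst c)"
    unfolding img using M.chart_open[OF c(2)] N.chart_open[OF c(3)]
    by (simp add: c openin_prod_Times_iff open_Times)
  show "homeomorphic_map (subtopology (mtop (prod_manifold M N)) (fst c)) (top_of_set (snd c ` fst c)) (snd c)"
  proof -
    obtain h1 h2 where
      "homeomorphic_maps (subtopology (mtop M) (fst c1)) (top_of_set (snd c1 ` fst c1)) (snd c1) h1"
      "homeomorphic_maps (subtopology (mtop N) (fst c2)) (top_of_set (snd c2 ` fst c2)) (snd c2) h2"
      using M.chart_homeomorphic[OF c(2)] N.chart_homeomorphic[OF c(3)]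
      by (auto simp: homeomorphic_map_maps)
    then have "homeomorphic_maps
      (prod_topology (subtopology (mtop M) (fst c1)) (subtopology (mtop N) (fst c2)))
      (prod_topology (top_of_set (snd c1 ` fst c1)) (top_of_set (snd c2 ` fst c2)))
      (\<lambda>(x, y). (snd c1 x, snd c2 y)) (\<lambda>(x, y). (h1 x, h2 y))"
      unfolding homeomorphic_maps_prod by blast
    then show ?thesis
      unfolding img by (auto simp: homeomorphic_map_maps c subtopology_Times map_prod_def)
  qed
  fix d assume "d \<in> atlas (prod_manifold M N)"
  then obtain d1 d2 where d: "d = prod_chart d1 d2" "d1 \<in> atlas M" "d2 \<in> atlas N"
    by (auto simp: atlas_prod_manifold)
  let ?S = "snd c ` (fst c \<inter> fst d)"
  show "smooth_on ?S (snd d \<circ> chart_inv c)"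
    unfolding smooth_on_iff_smooth_at
  proof
    fix z assume z: "z \<in> ?S"
    have 1: "smooth_at ?S (\<lambda>w. (snd d1 \<circ> chart_inv c1) (fst w)) z"
      by (rule smooth_at_compose[OF M.finite_dim_model smooth_at_bounded_linear[OF bounded_linear_fst] z,
            where T = "snd c1 ` (fst c1 \<inter> fst d1)"])
        (use M.chart_transition_smooth_at[OF c(2) d(2)] z c d in \<open>auto simp: comp_def\<close>)
    have 2: "smooth_at ?S (\<lambda>w. (snd d2 \<circ> chart_inv c2) (snd w)) z"
      by (rule smooth_at_compose[OF N.finite_dim_model smooth_at_bounded_linear[OF bounded_linear_snd] z,
            where T = "snd c2 ` (fst c2 \<inter> fst d2)"])
        (use N.chart_transition_smooth_at[OF c(3) d(3)] z c d in \<open>auto simp: comp_def\<close>)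
    show "smooth_at ?S (snd d \<circ> chart_inv c) z"
      by (rule smooth_at_transfer[OF smooth_at_Pair[OF 1 2] open_UNIV])
        (use c d in \<open>auto simp: chart_inv_prod_chart[OF M N]\<close>)
  qed
qed

lemma smooth_map_on_Pair:
  assumes f: "smooth_map_on M S N f" and g: "smooth_map_on M S P g"
    and M: "smooth_manifold M" and N: "smooth_manifold N" and P: "smooth_manifold P"
  shows "smooth_map_on M S (prod_manifold N P) (\<lambda>x. (f x, g x))"
proof (rule smooth_map_onI)
  show "S \<subseteq> topspace (mtop M)" using f by (rule smooth_map_on_subset)
  show "continuous_map (subtopology (mtop M) S) (mtop (prod_manifold N P)) (\<lambda>x. (f x, g x))"
    using f g by (simp add: smooth_map_on_def continuous_map_pairedI)
  fix p c d assume p: "p \<in> S" and c: "c \<in> charts_at M p" and "d \<in> charts_at (prod_manifold N P) (f p, g p)"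
  then obtain d1 d2 where d: "d = prod_chart d1 d2" "d1 \<in> charts_at N (f p)" "d2 \<in> charts_at P (g p)"
    by (auto simp: charts_at_prod_manifold)
  from smooth_at_Pair[OF smooth_map_on_germ[OF M N f p c d(2)] smooth_map_on_germ[OF M P g p c d(3)]]
  show "smooth_at (snd c ` (S \<inter> fst c)) (snd d \<circ> (\<lambda>x. (f x, g x)) \<circ> chart_inv c) (snd c p)"
    by (simp add: d comp_def)
qed

lemma smooth_map_on_fst:
  assumes M: "smooth_manifold M" and N: "smooth_manifold N"
    and S: "S \<subseteq> topspace (mtop M) \<times> topspace (mtop N)"
  shows "smooth_map_on (prod_manifold M N) S M fst"
proof (rule smooth_map_onI)
  interpret M: smooth_manifold M by fact
  show "S \<subseteq> topspace (mtop (prod_manifold M N))" using S by simp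
  show "continuous_map (subtopology (mtop (prod_manifold M N)) S) (mtop M) fst"
    by (simp add: continuous_map_from_subtopology continuous_map_fst)
  fix p c d assume p: "p \<in> S" and "c \<in> charts_at (prod_manifold M N) p" and d: "d \<in> charts_at M (fst p)"
  then obtain c1 c2 where c: "c = prod_chart c1 c2" "c1 \<in> charts_at M (fst p)" "c2 \<in> charts_at N (snd p)"
    by (cases p) (auto simp: charts_at_prod_manifold)
  note cd = charts_atD[OF c(2)] charts_atD[OF c(3)] charts_atD[OF d]
  let ?S = "snd c ` (S \<inter> fst c)"
  have top: "fst c1 \<subseteq> topspace (mtop M)" using cd M.chart_subset by blast
  have z: "snd c p \<in> ?S" using p cd by (cases p) (auto simp: c)
  have fst_p: "fst (snd c p) = snd c1 (fst p)" by (cases p) (simp add: c)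
  have "fst p \<in> topspace (mtop M)" using top cd by blast
  from smooth_map_on_germ[OF M M smooth_map_on_id[OF M subset_refl] this c(2) d]
  have germ: "smooth_at (snd c1 ` (topspace (mtop M) \<inter> fst c1))
      (snd d \<circ> (\<lambda>x. x) \<circ> chart_inv c1) (fst (snd c p))"
    unfolding fst_p .
  have "fst w \<in> snd c1 ` (topspace (mtop M) \<inter> fst c1)" if "w \<in> ?S" for w
    using that top by (auto simp: c)
  from smooth_at_compose[OF M.finite_dim_model smooth_at_bounded_linear[OF bounded_linear_fst] z germ this]
  have "smooth_at ?S (\<lambda>w. (snd d \<circ> (\<lambda>x. x) \<circ> chart_inv c1) (fst w)) (snd c p)" .
  then show "smooth_at ?S (snd d \<circ> fst \<circ> chart_inv c) (snd c p)"
    by (rule smooth_at_transfer[OF _ open_UNIV])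
      (use cd in \<open>auto simp: c chart_inv_prod_chart[OF M N]\<close>)
qed

lemma smooth_map_on_snd:
  assumes M: "smooth_manifold M" and N: "smooth_manifold N"
    and S: "S \<subseteq> topspace (mtop M) \<times> topspace (mtop N)"
  shows "smooth_map_on (prod_manifold M N) S N snd"
proof (rule smooth_map_onI)
  interpret N: smooth_manifold N by fact
  show "S \<subseteq> topspace (mtop (prod_manifold M N))" using S by simp
  show "continuous_map (subtopology (mtop (prod_manifold M N)) S) (mtop N) snd"
    by (simp add: continuous_map_from_subtopology continuous_map_snd)
  fix p c d assume p: "p \<in> S" and "c \<in> charts_at (prod_manifold M N) p" and d: "d \<in> charts_at N (snd p)"
  then obtain c1 c2 where c: "c = prod_chart c1 c2" "c1 \<in> charts_at M (fst p)" "c2 \<in> charts_at N (snd p)"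
    by (cases p) (auto simp: charts_at_prod_manifold)
  note cd = charts_atD[OF c(2)] charts_atD[OF c(3)] charts_atD[OF d]
  let ?S = "snd c ` (S \<inter> fst c)"
  have top: "fst c2 \<subseteq> topspace (mtop N)" using cd N.chart_subset by blast
  have z: "snd c p \<in> ?S" using p cd by (cases p) (auto simp: c)
  have snd_p: "snd (snd c p) = snd c2 (snd p)" by (cases p) (simp add: c)
  have "snd p \<in> topspace (mtop N)" using top cd by blast
  from smooth_map_on_germ[OF N N smooth_map_on_id[OF N subset_refl] this c(3) d]
  have germ: "smooth_at (snd c2 ` (topspace (mtop N) \<inter> fst c2))
      (snd d \<circ> (\<lambda>x. x) \<circ> chart_inv c2) (snd (snd c p))"
    unfolding snd_p .
  have "snd w \<in> snd c2 ` (topspace (mtop N) \<inter> fst c2)" if "w \<in> ?S" for w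
    using that top by (auto simp: c)
  from smooth_at_compose[OF N.finite_dim_model smooth_at_bounded_linear[OF bounded_linear_snd] z germ this]
  have "smooth_at ?S (\<lambda>w. (snd d \<circ> (\<lambda>x. x) \<circ> chart_inv c2) (snd w)) (snd c p)" .
  then show "smooth_at ?S (snd d \<circ> snd \<circ> chart_inv c) (snd c p)"
    by (rule smooth_at_transfer[OF _ open_UNIV])
      (use cd in \<open>auto simp: c chart_inv_prod_chart[OF M N]\<close>)
qed

section \<open>Tangent vectors and velocities\<close>

lemma smooth_map_differentiable:
  assumes M: "smooth_manifold M" and N: "smooth_manifold N" and f: "smooth_map M N f"
    and p: "p \<in> topspace (mtop M)" and c: "c \<in> charts_at M p" and d: "d \<in> charts_at N (f p)"
  shows "(snd d \<circ> f \<circ> chart_inv c) differentiable (at (snd c p))"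
  using smooth_map_on_germ[OF M N f p c d]
proof (rule smooth_at_differentiable)
  show "open (snd c ` (topspace (mtop M) \<inter> fst c))"
    using charts_atD[OF c] smooth_manifold.chart_image_open[OF M] by blast
  show "snd c p \<in> snd c ` (topspace (mtop M) \<inter> fst c)"
    using p charts_atD[OF c] by blast
qed

lemma smooth_curve_has_velocity:
  assumes M: "smooth_manifold M" and \<gamma>: "smooth_map_on real_manifold I M \<gamma>"
    and t: "t \<in> I" and c: "c \<in> charts_at M (\<gamma> t)"
  shows "((snd c \<circ> \<gamma>) has_vector_derivative velocity M I \<gamma> t c) (at t within I)"
proof -
  have "smooth_at I (snd c \<circ> \<gamma>) t"
    using smooth_map_on_germ[OF smooth_manifold_real M \<gamma> t _ c, of "(UNIV, id)"] by simp
  from smooth_at_differentiable_within[OF this t] show ?thesis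
    using c by (simp add: vector_derivative_works velocity_def)
qed

lemma tangent_space_outside_charts:
  "v \<in> tangent_space M p \<Longrightarrow> c \<notin> charts_at M p \<Longrightarrow> v c = 0"
  unfolding tangent_space_def by blast

lemma velocity_eqI:
  assumes "at t within I \<noteq> bot" "c \<in> charts_at M (\<gamma> t)"
    and "((snd c \<circ> \<gamma>) has_vector_derivative v) (at t within I)"
  shows "velocity M I \<gamma> t c = v"
  using assms vector_derivative_within[OF assms(1,3)] by (simp add: velocity_def)

text \<open>Curves are only relevant on \<open>I\<close>, and the group laws only hold for values in the carrier. This is
  how identities between curves that are valid on \<open>I\<close> are used.\<close>

lemma velocity_cong:
  fixes M :: "('m, 'e::real_normed_vector) manifold"
  assumes t: "t \<in> I" and eq: "\<And>x. x \<in> I \<Longrightarrow> \<gamma> x = \<gamma>' x"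
  shows "velocity M I \<gamma> t = velocity M I \<gamma>' t"
proof -
  have "((snd c \<circ> \<gamma>) has_vector_derivative v) (at t within I) \<longleftrightarrow>
      ((snd c \<circ> \<gamma>') has_vector_derivative v) (at t within I)" for c :: "('m, 'e) chart" and v
    using has_vector_derivative_transform[OF t, of "snd c \<circ> \<gamma>" "snd c \<circ> \<gamma>'" v]
      has_vector_derivative_transform[OF t, of "snd c \<circ> \<gamma>'" "snd c \<circ> \<gamma>" v] eq by auto
  then have "vector_derivative (snd c \<circ> \<gamma>) (at t within I) = vector_derivative (snd c \<circ> \<gamma>') (at t within I)"
    for c :: "('m, 'e) chart"
    unfolding vector_derivative_def by (simp only:)
  then show ?thesis
    unfolding velocity_def using eq[OF t] by (simp only:)
qed

lemma velocity_const:
  assumes "at t within I \<noteq> bot"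
  shows "velocity M I (\<lambda>_. q) t = 0"
proof
  fix c
  show "velocity M I (\<lambda>_. q) t c = 0 c"
  proof (cases "c \<in> charts_at M q")
    case True
    then show ?thesis by (simp add: velocity_eqI[OF assms] comp_def)
  qed (simp add: velocity_def)
qed

lemma velocity_compose_chart:
  assumes M: "smooth_manifold M" and N: "smooth_manifold N" and f: "smooth_map M N f"
    and \<gamma>: "smooth_map_on real_manifold I M \<gamma>" and t: "t \<in> I" "at t within I \<noteq> bot"
    and c: "c \<in> charts_at M (\<gamma> t)" and d: "d \<in> charts_at N (f (\<gamma> t))"
  shows "velocity N I (\<lambda>x. f (\<gamma> x)) t d =
    frechet_derivative (snd d \<circ> f \<circ> chart_inv c) (at (snd c (\<gamma> t))) (velocity M I \<gamma> t c)"
proof (rule velocity_eqI[where \<gamma> = "\<lambda>x. f (\<gamma> x)", OF t(2) d])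
  let ?D = "frechet_derivative (snd d \<circ> f \<circ> chart_inv c) (at (snd c (\<gamma> t)))"
  have c': "openin (mtop M) (fst c)" "\<gamma> t \<in> fst c" "c \<in> atlas M"
    using charts_atD[OF c] smooth_manifold.chart_open[OF M] by blast+
  have D: "((snd d \<circ> f \<circ> chart_inv c) has_derivative ?D) (at (snd c (\<gamma> t)))"
    using smooth_map_differentiable[OF M N f smooth_map_on_image[OF \<gamma> t(1)] c d]
    by (simp add: frechet_derivative_works)
  have "((\<lambda>x. (snd d \<circ> f \<circ> chart_inv c) ((snd c \<circ> \<gamma>) x)) has_vector_derivative
      ?D (velocity M I \<gamma> t c)) (at t within I)"
    using vector_derivative_diff_chain_within[OF smooth_curve_has_velocity[OF M \<gamma> t(1) c]
        has_derivative_at_withinI] D by (simp add: comp_def)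
  moreover obtain W where W: "open W" "t \<in> W" "\<And>x. x \<in> I \<Longrightarrow> x \<in> W \<Longrightarrow> \<gamma> x \<in> fst c"
    using smooth_map_on_chart_nbhd[OF smooth_manifold_real M \<gamma> t(1) _ c'(1,2), of "(UNIV, id)"]
    by auto
  moreover obtain e where "e > 0" "ball t e \<subseteq> W" using W open_contains_ball by blast
  ultimately show "((snd d \<circ> (\<lambda>x. f (\<gamma> x))) has_vector_derivative ?D (velocity M I \<gamma> t c)) (at t within I)"
    using t(1) c' by (elim has_vector_derivative_transform_within)
      (auto simp: smooth_manifold.chart_inv_left[OF M] dist_commute subset_iff)
qed

text \<open>In \<open>velocity_compose_chart\<close> the charts are arbitrary, whereas \<open>tangent_map\<close> uses a chosen chart at the
  base point.\<close>

lemma velocity_compose: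
  assumes M: "smooth_manifold M" and N: "smooth_manifold N" and f: "smooth_map M N f"
    and \<gamma>: "smooth_map_on real_manifold I M \<gamma>" and t: "t \<in> I" "at t within I \<noteq> bot"
  shows "velocity N I (\<lambda>x. f (\<gamma> x)) t = tangent_map M N f (\<gamma> t) (velocity M I \<gamma> t)"
proof
  fix d
  have "(SOME c. c \<in> charts_at M (\<gamma> t)) \<in> charts_at M (\<gamma> t)"
    using smooth_manifold.some_chart_at[OF M smooth_map_on_image[OF \<gamma> t(1)]] .
  from velocity_compose_chart[OF M N f \<gamma> t this]
  show "velocity N I (\<lambda>x. f (\<gamma> x)) t d = tangent_map M N f (\<gamma> t) (velocity M I \<gamma> t) d"
    by (auto simp: tangent_map_def velocity_def Let_def)
qed

text \<open>The chain rule for the identity map is the transformation law of tangent vectors.\<close>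

lemma velocity_in_tangent_space:
  assumes M: "smooth_manifold M" and \<gamma>: "smooth_map_on real_manifold I M \<gamma>"
    and t: "t \<in> I" "at t within I \<noteq> bot"
  shows "velocity M I \<gamma> t \<in> tangent_space M (\<gamma> t)"
  unfolding tangent_space_def
proof (intro CollectI conjI ballI allI impI)
  fix c d assume "c \<in> charts_at M (\<gamma> t)" "d \<in> charts_at M (\<gamma> t)"
  from velocity_compose_chart[OF M M smooth_map_on_id[OF M subset_refl] \<gamma> t this]
  show "velocity M I \<gamma> t d =
      frechet_derivative (snd d \<circ> chart_inv c) (at (snd c (\<gamma> t))) (velocity M I \<gamma> t c)"
    by (simp only: comp_def)
qed (simp add: velocity_def)

lemma velocity_Pair:
  assumes M: "smooth_manifold M" and N: "smooth_manifold N"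
    and \<alpha>: "smooth_map_on real_manifold I M \<alpha>" and \<beta>: "smooth_map_on real_manifold I N \<beta>"
    and t: "t \<in> I" "at t within I \<noteq> bot" and c: "c \<in> charts_at M (\<alpha> t)" and d: "d \<in> charts_at N (\<beta> t)"
  shows "velocity (prod_manifold M N) I (\<lambda>x. (\<alpha> x, \<beta> x)) t (prod_chart c d) =
    (velocity M I \<alpha> t c, velocity N I \<beta> t d)"
proof (rule velocity_eqI[OF t(2)])
  show "prod_chart c d \<in> charts_at (prod_manifold M N) (\<alpha> t, \<beta> t)"
    unfolding charts_at_prod_manifold using c d by blast
  from has_vector_derivative_Pair[OF smooth_curve_has_velocity[OF M \<alpha> t(1) c]
      smooth_curve_has_velocity[OF N \<beta> t(1) d]]
  show "((snd (prod_chart c d) \<circ> (\<lambda>x. (\<alpha> x, \<beta> x))) has_vector_derivative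
      (velocity M I \<alpha> t c, velocity N I \<beta> t d)) (at t within I)"
    by (simp add: comp_def)
qed

text \<open>This is the additivity of the derivative in the two factors. The constant curves stand
  for the embeddings of the two tangent spaces into that of the product.\<close>

lemma velocity_Pair_split:
  assumes M: "smooth_manifold M" and N: "smooth_manifold N"
    and \<alpha>: "smooth_map_on real_manifold I M \<alpha>" and \<beta>: "smooth_map_on real_manifold I N \<beta>"
    and t: "t \<in> I" "at t within I \<noteq> bot"
  shows "velocity (prod_manifold M N) I (\<lambda>x. (\<alpha> x, \<beta> x)) t =
    velocity (prod_manifold M N) I (\<lambda>x. (\<alpha> x, \<beta> t)) t +
    velocity (prod_manifold M N) I (\<lambda>x. (\<alpha> t, \<beta> x)) t"
proof
  have \<alpha>t: "smooth_map_on real_manifold I M (\<lambda>_. \<alpha> t)" and \<beta>t: "smooth_map_on real_manifold I N (\<lambda>_. \<beta> t)"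
    using smooth_map_on_image[OF \<alpha> t(1)] smooth_map_on_image[OF \<beta> t(1)]
    by (auto intro: smooth_map_on_const)
  fix k
  show "velocity (prod_manifold M N) I (\<lambda>x. (\<alpha> x, \<beta> x)) t k =
    (velocity (prod_manifold M N) I (\<lambda>x. (\<alpha> x, \<beta> t)) t +
    velocity (prod_manifold M N) I (\<lambda>x. (\<alpha> t, \<beta> x)) t) k"
  proof (cases "k \<in> charts_at (prod_manifold M N) (\<alpha> t, \<beta> t)")
    case True
    then obtain c d where k: "k = prod_chart c d" and c: "c \<in> charts_at M (\<alpha> t)" and d: "d \<in> charts_at N (\<beta> t)"
      unfolding charts_at_prod_manifold by blast
    show ?thesis
      using velocity_Pair[OF M N \<alpha> \<beta> t c d] velocity_Pair[OF M N \<alpha> \<beta>t t c d]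
        velocity_Pair[OF M N \<alpha>t \<beta> t c d]
      by (simp add: k velocity_const[OF t(2)])
  qed (simp add: velocity_def)
qed

lemma tangent_map_linear:
  assumes M: "smooth_manifold M" and N: "smooth_manifold N" and f: "smooth_map M N f"
    and p: "p \<in> topspace (mtop M)"
  shows "linear (tangent_map M N f p)"
proof (rule linearI)
  let ?c = "SOME c. c \<in> charts_at M p"
  have lin: "linear (frechet_derivative (snd d \<circ> f \<circ> chart_inv ?c) (at (snd ?c p)))"
    if "d \<in> charts_at N (f p)" for d
    using smooth_map_differentiable[OF M N f p smooth_manifold.some_chart_at[OF M p] that]
    by (rule linear_frechet_derivative)
  show "tangent_map M N f p (v + w) = tangent_map M N f p v + tangent_map M N f p w" for v w
    using lin by (auto simp: tangent_map_def Let_def fun_eq_iff linear_add)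
  show "tangent_map M N f p (r *\<^sub>R v) = r *\<^sub>R tangent_map M N f p v" for r v
    using lin by (auto simp: tangent_map_def Let_def fun_eq_iff linear_scale scaleR_fun_def)
qed

lemma tangent_map_compose:
  assumes M: "smooth_manifold M" and N: "smooth_manifold N" and P: "smooth_manifold P"
    and f: "smooth_map M N f" and g: "smooth_map N P g" and p: "p \<in> topspace (mtop M)"
  shows "tangent_map N P g (f p) (tangent_map M N f p v) = tangent_map M P (\<lambda>x. g (f x)) p v"
proof
  fix e
  interpret M: smooth_manifold M by fact
  interpret N: smooth_manifold N by fact
  define c d where "c = (SOME c. c \<in> charts_at M p)" and "d = (SOME d. d \<in> charts_at N (f p))"
  have fp: "f p \<in> topspace (mtop N)" using smooth_map_on_image[OF f p] .
  have c: "c \<in> charts_at M p" unfolding c_def by (rule M.some_chart_at[OF p])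
  have d: "d \<in> charts_at N (f p)" unfolding d_def by (rule N.some_chart_at[OF fp])
  note cd = charts_atD[OF c] charts_atD[OF d]
  show "tangent_map N P g (f p) (tangent_map M N f p v) e = tangent_map M P (\<lambda>x. g (f x)) p v e"
  proof (cases "e \<in> charts_at P (g (f p))")
    case True
    let ?F = "snd d \<circ> f \<circ> chart_inv c" and ?G = "snd e \<circ> g \<circ> chart_inv d"
    have F: "?F differentiable (at (snd c p))" by (rule smooth_map_differentiable[OF M N f p c d])
    have Fp: "?F (snd c p) = snd d (f p)" using cd by simp
    have G: "?G differentiable (at (?F (snd c p)))"
      unfolding Fp by (rule smooth_map_differentiable[OF N P g fp d True])
    have "openin (mtop N) (fst d)" "f p \<in> fst d" using cd N.chart_open by blast+
    from smooth_map_on_chart_nbhd[OF M N f p c this]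
    obtain W where W: "open W" "snd c p \<in> W"
      "\<And>x. x \<in> topspace (mtop M) \<Longrightarrow> x \<in> fst c \<Longrightarrow> snd c x \<in> W \<Longrightarrow> f x \<in> fst d" by blast
    let ?W = "W \<inter> snd c ` (topspace (mtop M) \<inter> fst c)"
    have "open ?W" using W(1) M.chart_image_open[of c "topspace (mtop M)"] cd by auto
    moreover have "snd c p \<in> ?W" using W p cd by auto
    moreover have "(?G \<circ> ?F) y = (snd e \<circ> (\<lambda>x. g (f x)) \<circ> chart_inv c) y" if "y \<in> ?W" for y
      using that W(3) cd by auto
    ultimately have "frechet_derivative (?G \<circ> ?F) (at (snd c p)) =
        frechet_derivative (snd e \<circ> (\<lambda>x. g (f x)) \<circ> chart_inv c) (at (snd c p))"
      using F G by (intro frechet_derivative_transform_within_open[of _ _ ?W] differentiable_chain_at)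
    then show ?thesis
      using True d unfolding frechet_derivative_compose[OF F G] Fp
      by (simp add: tangent_map_def Let_def fun_eq_iff flip: c_def d_def)
  qed (simp add: tangent_map_def Let_def)
qed

lemma tangent_map_cong:
  assumes M: "smooth_manifold M" and N: "smooth_manifold N" and f: "smooth_map M N f"
    and p: "p \<in> topspace (mtop M)" and eq: "\<And>x. x \<in> topspace (mtop M) \<Longrightarrow> f x = g x"
  shows "tangent_map M N f p = tangent_map M N g p"
proof (intro ext)
  fix v d
  interpret M: smooth_manifold M by fact
  define c where "c = (SOME c. c \<in> charts_at M p)"
  have c: "c \<in> charts_at M p" unfolding c_def by (rule M.some_chart_at[OF p])
  let ?W = "snd c ` (topspace (mtop M) \<inter> fst c)"
  show "tangent_map M N f p v d = tangent_map M N g p v d"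
  proof (cases "d \<in> charts_at N (f p)")
    case True
    have "open ?W" using M.chart_image_open charts_atD[OF c] by blast
    moreover have "snd c p \<in> ?W" using p charts_atD[OF c] by blast
    moreover have "(snd d \<circ> f \<circ> chart_inv c) y = (snd d \<circ> g \<circ> chart_inv c) y" if "y \<in> ?W" for y
      using that eq charts_atD[OF c] by auto
    ultimately have "frechet_derivative (snd d \<circ> f \<circ> chart_inv c) (at (snd c p)) =
        frechet_derivative (snd d \<circ> g \<circ> chart_inv c) (at (snd c p))"
      using smooth_map_differentiable[OF M N f p c True]
      by (intro frechet_derivative_transform_within_open[of _ _ ?W])
    then show ?thesis using True eq[OF p] by (simp add: tangent_map_def Let_def flip: c_def)
  qed (use eq[OF p] in \<open>simp add: tangent_map_def Let_def\<close>)
qed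

lemma tangent_map_id:
  assumes M: "smooth_manifold M" and p: "p \<in> topspace (mtop M)" and v: "v \<in> tangent_space M p"
  shows "tangent_map M M (\<lambda>x. x) p v = v"
proof
  let ?c = "SOME c. c \<in> charts_at M p"
  have c: "?c \<in> charts_at M p" by (rule smooth_manifold.some_chart_at[OF M p])
  fix d
  show "tangent_map M M (\<lambda>x. x) p v d = v d"
  proof (cases "d \<in> charts_at M p")
    case True
    then have "v d = frechet_derivative (snd d \<circ> chart_inv ?c) (at (snd ?c p)) (v ?c)"
      using v c unfolding tangent_space_def by blast
    moreover have "snd d \<circ> (\<lambda>x. x) \<circ> chart_inv ?c = snd d \<circ> chart_inv ?c" by (simp add: comp_def)
    ultimately show ?thesis using True by (simp only: tangent_map_def Let_def if_True)
  qed (use tangent_space_outside_charts[OF v] in \<open>simp add: tangent_map_def Let_def\<close>)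
qed

section \<open>Tangent spaces as vector spaces\<close>

text \<open>The tangent vector at \<open>p\<close> whose expression in the chart \<open>c\<close> is \<open>y\<close>.\<close>

definition tangent_extension ::
  "('m, 'e::real_normed_vector) manifold \<Rightarrow> 'm \<Rightarrow> ('m, 'e) chart \<Rightarrow> 'e \<Rightarrow> ('m, 'e) tangent" where
  "tangent_extension M p c y =
     (\<lambda>d. if d \<in> charts_at M p then frechet_derivative (snd d \<circ> chart_inv c) (at (snd c p)) y else 0)"

lemma tangent_extension_eq:
  assumes v: "v \<in> tangent_space M p" and c: "c \<in> charts_at M p"
  shows "tangent_extension M p c (v c) = v"
proof
  fix d
  show "tangent_extension M p c (v c) d = v d"
  proof (cases "d \<in> charts_at M p")
    case True
    then have "v d = frechet_derivative (snd d \<circ> chart_inv c) (at (snd c p)) (v c)"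
      using v c unfolding tangent_space_def by blast
    with True show ?thesis by (simp only: tangent_extension_def if_True)
  qed (use tangent_space_outside_charts[OF v] in \<open>simp add: tangent_extension_def\<close>)
qed

lemma chart_transition_differentiable:
  assumes M: "smooth_manifold M" and c: "c \<in> charts_at M p" and d: "d \<in> charts_at M p"
  shows "(snd d \<circ> chart_inv c) differentiable (at (snd c p))"
proof -
  have "p \<in> topspace (mtop M)" using charts_atD[OF c] smooth_manifold.chart_subset[OF M] by blast
  from smooth_map_differentiable[OF M M smooth_map_on_id[OF M subset_refl] this c d]
  show ?thesis by (simp add: comp_def)
qed

lemma tangent_extension_linear:
  assumes M: "smooth_manifold M" and c: "c \<in> charts_at M p"
  shows "linear (tangent_extension M p c)"
proof (rule linearI)
  have lin: "linear (frechet_derivative (snd d \<circ> chart_inv c) (at (snd c p)))"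
    if "d \<in> charts_at M p" for d
    using chart_transition_differentiable[OF M c that] by (rule linear_frechet_derivative)
  show "tangent_extension M p c (v + w) = tangent_extension M p c v + tangent_extension M p c w" for v w
    using lin by (auto simp: tangent_extension_def fun_eq_iff linear_add)
  show "tangent_extension M p c (r *\<^sub>R v) = r *\<^sub>R tangent_extension M p c v" for r v
    using lin by (auto simp: tangent_extension_def fun_eq_iff linear_scale scaleR_fun_def)
qed

lemma tangent_space_uminus:
  assumes M: "smooth_manifold M" and v: "v \<in> tangent_space M p"
  shows "- v \<in> tangent_space M p"
  unfolding tangent_space_def
proof (intro CollectI conjI ballI allI impI)
  fix c d assume cd: "c \<in> charts_at M p" "d \<in> charts_at M p"
  then have "v d = frechet_derivative (snd d \<circ> chart_inv c) (at (snd c p)) (v c)"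
    using v unfolding tangent_space_def by blast
  with linear_neg[OF linear_frechet_derivative[OF chart_transition_differentiable[OF M cd]]]
  show "(- v) d = frechet_derivative (snd d \<circ> chart_inv c) (at (snd c p)) ((- v) c)" by simp
qed (use tangent_space_outside_charts[OF v] in simp)

section \<open>Families of curves and constant curves\<close>

text \<open>For functions with real values, continuity follows from smoothness in the charts, because the whole
  line is one chart of the target.\<close>

lemma smooth_real_functionI:
  assumes N: "smooth_manifold N" and S: "S \<subseteq> topspace (mtop N)"
    and f: "\<And>p c. p \<in> S \<Longrightarrow> c \<in> charts_at N p \<Longrightarrow>
      smooth_at (snd c ` (S \<inter> fst c)) (f \<circ> chart_inv c) (snd c p)"
  shows "smooth_map_on N S real_manifold f"
proof (rule smooth_map_onI[OF S])
  interpret N: smooth_manifold N by fact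
  show "continuous_map (subtopology (mtop N) S) (mtop real_manifold) f"
    unfolding continuous_map_eq_topcontinuous_at topcontinuous_at_def
  proof (intro ballI conjI allI impI)
    fix p V
    assume p: "p \<in> topspace (subtopology (mtop N) S)" and "openin (mtop real_manifold) V \<and> f p \<in> V"
    then have V: "open V" "f p \<in> V" and pS: "p \<in> S"
      by (auto simp: real_manifold_def)
    obtain c where c: "c \<in> charts_at N p" using N.charts_at_nonempty S pS by blast
    note c' = charts_atD[OF c]
    have "snd c p \<in> snd c ` (S \<inter> fst c)" "(f \<circ> chart_inv c) (snd c p) \<in> V" using pS c' V by auto
    from smooth_at_nbhd[OF f[OF pS c] this(1) V(1) this(2)]
    obtain W where W: "open W" "snd c p \<in> W"
      "\<And>y. y \<in> snd c ` (S \<inter> fst c) \<Longrightarrow> y \<in> W \<Longrightarrow> (f \<circ> chart_inv c) y \<in> V" by blast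
    let ?U = "{x \<in> fst c. snd c x \<in> W} \<inter> S"
    have "openin (subtopology (mtop N) S) ?U"
      using c' W(1) by (intro openin_subtopology_Int N.chart_continuous) auto
    moreover have "p \<in> ?U" using pS c' W by auto
    moreover have "f x \<in> V" if "x \<in> ?U" for x using that W(3)[of "snd c x"] c' by auto
    ultimately show "\<exists>U. openin (subtopology (mtop N) S) U \<and> p \<in> U \<and> (\<forall>y\<in>U. f y \<in> V)" by blast
  qed auto
qed (use f in simp)

text \<open>In a fixed chart around \<open>q\<close> the velocities are partial derivatives of a smooth map, and a tangent
  vector at \<open>q\<close> is a linear function of its expression in that chart. The condition that all the
  curves pass through the same point \<open>q\<close> at the chosen time allows one chart to be used for all of them.\<close>

lemma smooth_velocity_family:
  fixes M :: "('m, 'e::real_normed_vector) manifold" and N :: "('n, 'f::real_normed_vector) manifold"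
  assumes M: "smooth_manifold M" and N: "smooth_manifold N"
    and \<kappa>: "smooth_map_on (prod_manifold real_manifold N) (I \<times> S) M (\<lambda>(x, s). \<kappa> x s)"
    and \<tau>: "smooth_map_on N S real_manifold \<tau>" and \<tau>I: "\<And>s. s \<in> S \<Longrightarrow> \<tau> s \<in> I"
    and I: "\<And>t. t \<in> I \<Longrightarrow> at t within I \<noteq> bot" and q: "\<And>s. s \<in> S \<Longrightarrow> \<kappa> (\<tau> s) s = q"
    and l: "linear (l :: ('m, 'e) tangent \<Rightarrow> real)"
  shows "smooth_map_on N S real_manifold (\<lambda>s. l (velocity M I (\<lambda>x. \<kappa> x s) (\<tau> s)))"
proof (rule smooth_real_functionI[OF N])
  interpret M: smooth_manifold M by fact
  interpret N: smooth_manifold N by fact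
  note RN = smooth_manifold_prod[OF smooth_manifold_real N]
  show S: "S \<subseteq> topspace (mtop N)" using \<tau> by (rule smooth_map_on_subset)
  fix p c assume p: "p \<in> S" and c: "c \<in> charts_at N p"
  note c' = charts_atD[OF c]
  have "q \<in> topspace (mtop M)"
    using smooth_map_on_image[OF \<kappa>, of "(\<tau> p, p)"] p \<tau>I q by auto
  then obtain e where e: "e \<in> charts_at M q" using M.charts_at_nonempty by blast
  let ?S = "snd c ` (S \<inter> fst c)"
  let ?f = "\<lambda>(x, y). snd e (\<kappa> x (chart_inv c y))"
  have k: "prod_chart (UNIV, id) c \<in> charts_at (prod_manifold real_manifold N) (\<tau> p, p)"
    unfolding charts_at_prod_manifold using c by (intro CollectI exI conjI) (rule refl, simp_all)
  have img: "snd (prod_chart (UNIV, id) c) ` (I \<times> S \<inter> fst (prod_chart (UNIV, id) c)) = I \<times> ?S"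
    by (simp add: Times_Int_Times map_prod_surj_on)
  have "smooth_at (I \<times> ?S) (snd e \<circ> (\<lambda>(x, s). \<kappa> x s) \<circ> chart_inv (prod_chart (UNIV, id) c)) (\<tau> p, snd c p)"
    using smooth_map_on_germ[OF RN M \<kappa> _ k, of e] e p q \<tau>I unfolding img by simp
  then have f: "smooth_at (I \<times> ?S) ?f (\<tau> p, snd c p)"
  proof (rule smooth_at_transfer[OF _ open_UNIV])
    fix z assume "z \<in> I \<times> ?S"
    then obtain x s where "z = (x, snd c s)" "s \<in> fst c" by auto
    moreover from this have "chart_inv (prod_chart (UNIV, id) c) (x, snd c s) = (x, s)"
      using chart_inv_prod_chart[OF smooth_manifold_real N, of "(UNIV, id)" c x s] c'
      by (simp add: real_manifold_def)
    ultimately show "(snd e \<circ> (\<lambda>(x, s). \<kappa> x s) \<circ> chart_inv (prod_chart (UNIV, id) c)) z = ?f z"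
      using c' by simp
  qed auto
  have \<tau>': "smooth_at ?S (\<tau> \<circ> chart_inv c) (snd c p)"
    using smooth_map_on_germ[OF N smooth_manifold_real \<tau> p c, of "(UNIV, id)"] by simp
  let ?L = "\<lambda>y. l (tangent_extension M q e y)"
  have L: "bounded_linear ?L"
    using linear_compose[OF tangent_extension_linear[OF M e] l]
    by (intro finite_dim_linear_bounded[OF M.finite_dim_model]) (simp add: comp_def)
  have "smooth_at ?S (\<lambda>y. vector_derivative (\<lambda>x. ?f (x, y)) (at ((\<tau> \<circ> chart_inv c) y) within I)) (snd c p)"
    by (rule smooth_at_partial_derivative[OF N.finite_dim_model _ \<tau>' _ _ I]) (use f p c' \<tau>I in auto)
  from smooth_at_linear_compose[OF L this]
  show "smooth_at ?S ((\<lambda>s. l (velocity M I (\<lambda>x. \<kappa> x s) (\<tau> s))) \<circ> chart_inv c) (snd c p)"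
  proof (rule smooth_at_transfer[OF _ open_UNIV])
    fix y assume "y \<in> ?S"
    then obtain s where s: "s \<in> S" "s \<in> fst c" "y = snd c s" by auto
    have "smooth_map_on real_manifold I (prod_manifold real_manifold N) (\<lambda>x. (x, s))"
      using S s by (intro smooth_map_on_Pair smooth_map_on_id smooth_map_on_const smooth_manifold_real N) auto
    from smooth_map_on_compose[OF smooth_manifold_real RN M this \<kappa>] s(1)
    have curve: "smooth_map_on real_manifold I M (\<lambda>x. \<kappa> x s)" by simp
    have "velocity M I (\<lambda>x. \<kappa> x s) (\<tau> s) \<in> tangent_space M q"
      using velocity_in_tangent_space[OF M curve \<tau>I I] s(1) \<tau>I q by metis
    from tangent_extension_eq[OF this e]
    have ext: "l (velocity M I (\<lambda>x. \<kappa> x s) (\<tau> s)) = ?L (velocity M I (\<lambda>x. \<kappa> x s) (\<tau> s) e)"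
      by simp
    have inv: "chart_inv c y = s" using s c' by simp
    have "velocity M I (\<lambda>x. \<kappa> x s) (\<tau> s) e = vector_derivative (snd e \<circ> (\<lambda>x. \<kappa> x s)) (at (\<tau> s) within I)"
      using q s(1) e by (simp add: velocity_def)
    then show "?L (vector_derivative (\<lambda>x. ?f (x, y)) (at ((\<tau> \<circ> chart_inv c) y) within I)) =
        ((\<lambda>s. l (velocity M I (\<lambda>x. \<kappa> x s) (\<tau> s))) \<circ> chart_inv c) y"
      unfolding comp_apply case_prod_conv inv ext by (simp add: comp_def)
  qed auto
qed

text \<open>In a chart around \<open>\<gamma> a\<close> the derivative vanishes, so \<open>\<gamma>\<close> is constant near \<open>a\<close>, and intervals are
  connected.\<close>

lemma velocity_zero_imp_constant:
  assumes M: "smooth_manifold M" and \<gamma>: "smooth_map_on real_manifold I M \<gamma>" and I: "is_interval I"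
    and zero: "\<And>t. t \<in> I \<Longrightarrow> velocity M I \<gamma> t = 0" and s: "s \<in> I" and t: "t \<in> I"
  shows "\<gamma> s = \<gamma> t"
proof (rule connected_local_const[OF is_interval_connected[OF I] s t], rule ballI)
  interpret M: smooth_manifold M by fact
  fix a assume a: "a \<in> I"
  obtain c where c: "c \<in> charts_at M (\<gamma> a)"
    using M.charts_at_nonempty smooth_map_on_image[OF \<gamma> a] by blast
  have c': "openin (mtop M) (fst c)" "\<gamma> a \<in> fst c" "c \<in> atlas M"
    using charts_atD[OF c] M.chart_open by blast+
  obtain W where W: "open W" "a \<in> W" "\<And>x. x \<in> I \<Longrightarrow> x \<in> W \<Longrightarrow> \<gamma> x \<in> fst c"
    using smooth_map_on_chart_nbhd[OF smooth_manifold_real M \<gamma> a _ c'(1,2), of "(UNIV, id)"] by auto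
  obtain e where e: "e > 0" "ball a e \<subseteq> W" using W open_contains_ball by blast
  have "((snd c \<circ> \<gamma>) has_vector_derivative 0) (at x within I \<inter> ball a e)" if "x \<in> I \<inter> ball a e" for x
  proof -
    have "c \<in> charts_at M (\<gamma> x)" using that e W(3) c' by (auto simp: charts_at_def)
    from smooth_curve_has_velocity[OF M \<gamma> _ this] zero[of x] that
    have "((snd c \<circ> \<gamma>) has_vector_derivative 0) (at x within I)" by simp
    then show ?thesis by (rule has_vector_derivative_within_subset) simp
  qed
  then obtain k where k: "\<And>x. x \<in> I \<inter> ball a e \<Longrightarrow> (snd c \<circ> \<gamma>) x = k"
    using has_vector_derivative_zero_constant[of "I \<inter> ball a e" "snd c \<circ> \<gamma>"]
      convex_Int[OF is_interval_convex[OF I] convex_ball] by metis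
  have "\<gamma> a = \<gamma> x" if "x \<in> I" "x \<in> ball a e" for x
  proof -
    have "snd c (\<gamma> a) = snd c (\<gamma> x)" using k[of a] k[of x] a e that by simp
    then show ?thesis using M.chart_inj[OF c'(3)] c' W(3) that e by (metis inj_onD subsetD)
  qed
  then show "\<forall>\<^sub>F b in at a within I. \<gamma> a = \<gamma> b"
    unfolding eventually_at using e(1) by (auto simp: dist_commute)
qed

section \<open>Smooth maps into Lie groups\<close>

context lie_group
begin

lemma smooth_map_on_carrier: "smooth_map_on N S (mfd G) f \<Longrightarrow> x \<in> S \<Longrightarrow> f x \<in> carrier G"
  using smooth_map_on_image topspace_eq_carrier by metis

lemma smooth_map_on_mult:
  assumes N: "smooth_manifold N" and f: "smooth_map_on N S (mfd G) f" and g: "smooth_map_on N S (mfd G) g"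
  shows "smooth_map_on N S (mfd G) (\<lambda>x. f x \<otimes> g x)"
proof -
  note GG = smooth_manifold_prod[OF manifold manifold]
  have "(f x, g x) \<in> topspace (mtop (prod_manifold (mfd G) (mfd G)))" if "x \<in> S" for x
    using smooth_map_on_image[OF f that] smooth_map_on_image[OF g that] by simp
  from smooth_map_on_compose[OF N GG manifold smooth_map_on_Pair[OF f g N manifold manifold] smooth_mult this]
  show ?thesis by simp
qed

lemma smooth_map_on_inv:
  assumes N: "smooth_manifold N" and f: "smooth_map_on N S (mfd G) f"
  shows "smooth_map_on N S (mfd G) (\<lambda>x. inv (f x))"
  using smooth_map_on_compose[OF N manifold manifold f smooth_inv smooth_map_on_image[OF f]] .

lemma smooth_map_on_const_carrier:
  assumes "S \<subseteq> topspace (mtop N)" "g \<in> carrier G"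
  shows "smooth_map_on N S (mfd G) (\<lambda>_. g)"
  using assms topspace_eq_carrier by (intro smooth_map_on_const) auto

lemma smooth_map_right_translation:
  assumes g: "g \<in> carrier G"
  shows "smooth_map (mfd G) (mfd G) (right_translation G g)"
  unfolding right_translation_def
  by (intro smooth_map_on_mult smooth_map_on_id smooth_map_on_const_carrier manifold g subset_refl)

lemma smooth_map_conjugation:
  assumes g: "g \<in> carrier G"
  shows "smooth_map (mfd G) (mfd G) (\<lambda>x. g \<otimes> x \<otimes> inv g)"
  by (intro smooth_map_on_mult smooth_map_on_id smooth_map_on_const_carrier manifold g inv_closed subset_refl)

lemma one_in_topspace: "\<one> \<in> topspace (mtop (mfd G))"
  by (simp add: topspace_eq_carrier)

lemma Ad_linear: "g \<in> carrier G \<Longrightarrow> linear (Ad G g)"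
  unfolding Ad_def
  by (intro tangent_map_linear manifold smooth_map_conjugation one_in_topspace)

text \<open>Translating by \<open>g\<close> and then by its inverse is the identity on the carrier only, so the functoriality of
  tangent maps is combined with \<open>tangent_map_cong\<close>.\<close>

lemma tangent_right_translation_inv:
  assumes g: "g \<in> carrier G" and v: "v \<in> lie_algebra G"
  shows "tangent_map (mfd G) (mfd G) (right_translation G (inv g)) g
    (tangent_map (mfd G) (mfd G) (right_translation G g) \<one> v) = v"
proof -
  let ?R = "\<lambda>x. right_translation G (inv g) (right_translation G g x)"
  have R: "smooth_map (mfd G) (mfd G) (right_translation G g)"
    "smooth_map (mfd G) (mfd G) (right_translation G (inv g))"
    using g by (auto intro: smooth_map_right_translation)
  have eq: "x = ?R x" if "x \<in> topspace (mtop (mfd G))" for x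
    using that g by (simp add: right_translation_def topspace_eq_carrier m_assoc)
  have "tangent_map (mfd G) (mfd G) (right_translation G (inv g)) g
      (tangent_map (mfd G) (mfd G) (right_translation G g) \<one> v) = tangent_map (mfd G) (mfd G) ?R \<one> v"
    using tangent_map_compose[OF manifold manifold manifold R one_in_topspace, of v] g
    by (simp add: right_translation_def)
  also have "\<dots> = tangent_map (mfd G) (mfd G) (\<lambda>x. x) \<one> v"
    using tangent_map_cong[OF manifold manifold smooth_map_on_id[OF manifold subset_refl] one_in_topspace eq]
    by simp
  also have "\<dots> = v" by (rule tangent_map_id[OF manifold one_in_topspace v])
  finally show ?thesis .
qed

end

section \<open>The right logarithmic derivative of a curve in a Lie group\<close>

text \<open>The curve \<open>x \<mapsto> \<gamma> x \<otimes> inv (\<gamma> t)\<close> is used instead of the translated tangent vector, because then rules for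
  the logarithmic derivative follow from identities between curves. The two descriptions agree by
  \<open>log_velocity_eq_translated_velocity\<close>.\<close>

definition log_velocity ::
  "('g, 'e::real_normed_vector) lie_group_data \<Rightarrow> real set \<Rightarrow> (real \<Rightarrow> 'g) \<Rightarrow> real \<Rightarrow> ('g, 'e) tangent" where
  "log_velocity G I \<gamma> t = velocity (mfd G) I (\<lambda>x. \<gamma> x \<otimes>\<^bsub>G\<^esub> inv\<^bsub>G\<^esub> (\<gamma> t)) t"

text \<open>The condition on \<open>I\<close> makes derivatives within \<open>I\<close> unique; nontrivial intervals satisfy it.\<close>

locale lie_group_curves = lie_group +
  fixes I :: "real set"
  assumes no_isolated_point: "t \<in> I \<Longrightarrow> at t within I \<noteq> bot"
begin

abbreviation smooth_curve :: "(real \<Rightarrow> 'a) \<Rightarrow> bool" where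
  "smooth_curve \<gamma> \<equiv> smooth_map_on real_manifold I (mfd G) \<gamma>"

lemma smooth_curve_intros:
  "smooth_curve \<alpha> \<Longrightarrow> smooth_curve \<beta> \<Longrightarrow> smooth_curve (\<lambda>x. \<alpha> x \<otimes> \<beta> x)"
  "smooth_curve \<alpha> \<Longrightarrow> smooth_curve (\<lambda>x. inv (\<alpha> x))"
  "g \<in> carrier G \<Longrightarrow> smooth_curve (\<lambda>_. g)"
  by (auto intro: smooth_map_on_mult smooth_map_on_inv smooth_map_on_const_carrier smooth_manifold_real)

lemma curve_carrier: "smooth_curve \<gamma> \<Longrightarrow> x \<in> I \<Longrightarrow> \<gamma> x \<in> carrier G"
  by (rule smooth_map_on_carrier)

lemma smooth_curve_quotient:
  "smooth_curve \<gamma> \<Longrightarrow> t \<in> I \<Longrightarrow> smooth_curve (\<lambda>x. \<gamma> x \<otimes> inv (\<gamma> t))"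
  by (intro smooth_curve_intros inv_closed curve_carrier)

text \<open>The derivative of the multiplication at the identity is addition. Its two partial derivatives are
  identities, since keeping one factor at the identity reduces the product to the other factor.\<close>

lemma velocity_mult:
  assumes \<alpha>: "smooth_curve \<alpha>" and \<beta>: "smooth_curve \<beta>" and t: "t \<in> I"
    and one: "\<alpha> t = \<one>" "\<beta> t = \<one>"
  shows "velocity (mfd G) I (\<lambda>x. \<alpha> x \<otimes> \<beta> x) t = velocity (mfd G) I \<alpha> t + velocity (mfd G) I \<beta> t"
proof -
  let ?M = "mfd G" and ?m = "\<lambda>(x, y). x \<otimes> y"
  note GG = smooth_manifold_prod[OF manifold manifold]
  note t' = t no_isolated_point[OF t]
  have chain: "velocity ?M I (\<lambda>x. \<gamma> x \<otimes> \<delta> x) t =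
      tangent_map (prod_manifold ?M ?M) ?M ?m (\<one>, \<one>) (velocity (prod_manifold ?M ?M) I (\<lambda>x. (\<gamma> x, \<delta> x)) t)"
    if "smooth_curve \<gamma>" "smooth_curve \<delta>" "\<gamma> t = \<one>" "\<delta> t = \<one>" for \<gamma> \<delta>
    using velocity_compose[OF GG manifold smooth_mult
        smooth_map_on_Pair[OF that(1,2) smooth_manifold_real manifold manifold] t'] that(3,4)
    by simp
  have c1: "smooth_curve (\<lambda>_. \<one>)" by (simp add: smooth_curve_intros)
  have lin: "linear (tangent_map (prod_manifold ?M ?M) ?M ?m (\<one>, \<one>))"
    by (rule tangent_map_linear[OF GG manifold smooth_mult]) (simp add: topspace_eq_carrier)
  have "velocity ?M I (\<lambda>x. \<alpha> x \<otimes> \<beta> x) t =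
      velocity ?M I (\<lambda>x. \<alpha> x \<otimes> \<one>) t + velocity ?M I (\<lambda>x. \<one> \<otimes> \<beta> x) t"
    using velocity_Pair_split[OF manifold manifold \<alpha> \<beta> t'] one
    by (simp add: chain \<alpha> \<beta> c1 linear_add[OF lin])
  also have "velocity ?M I (\<lambda>x. \<alpha> x \<otimes> \<one>) t = velocity ?M I \<alpha> t"
    by (rule velocity_cong[OF t]) (simp add: curve_carrier[OF \<alpha>])
  also have "velocity ?M I (\<lambda>x. \<one> \<otimes> \<beta> x) t = velocity ?M I \<beta> t"
    by (rule velocity_cong[OF t]) (simp add: curve_carrier[OF \<beta>])
  finally show ?thesis .
qed

lemma log_velocity_in_lie_algebra:
  assumes \<gamma>: "smooth_curve \<gamma>" and t: "t \<in> I"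
  shows "log_velocity G I \<gamma> t \<in> lie_algebra G"
  using velocity_in_tangent_space[OF manifold smooth_curve_quotient[OF \<gamma> t] t no_isolated_point[OF t]]
  by (simp add: log_velocity_def curve_carrier[OF \<gamma> t])

lemma log_velocity_cong:
  assumes "t \<in> I" "\<And>x. x \<in> I \<Longrightarrow> \<alpha> x = \<beta> x"
  shows "log_velocity G I \<alpha> t = log_velocity G I \<beta> t"
  unfolding log_velocity_def using assms by (intro velocity_cong) simp_all

lemma log_velocity_const: "t \<in> I \<Longrightarrow> log_velocity G I (\<lambda>_. g) t = 0"
  unfolding log_velocity_def by (intro velocity_const no_isolated_point)

lemma log_velocity_eq_translated_velocity:
  assumes \<gamma>: "smooth_curve \<gamma>" and t: "t \<in> I"
  shows "log_velocity G I \<gamma> t =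
    tangent_map (mfd G) (mfd G) (right_translation G (inv (\<gamma> t))) (\<gamma> t) (velocity (mfd G) I \<gamma> t)"
  using velocity_compose[OF manifold manifold
      smooth_map_right_translation[OF inv_closed[OF curve_carrier[OF \<gamma> t]]] \<gamma> t no_isolated_point[OF t]]
  by (simp add: log_velocity_def right_translation_def)

lemma velocity_eq_right_invariant_field:
  assumes \<gamma>: "smooth_curve \<gamma>" and t: "t \<in> I"
  shows "velocity (mfd G) I \<gamma> t = right_invariant_field G (log_velocity G I \<gamma> t) (\<gamma> t)"
proof -
  let ?\<alpha> = "\<lambda>x. \<gamma> x \<otimes> inv (\<gamma> t)"
  note car = curve_carrier[OF \<gamma>]
  have "velocity (mfd G) I \<gamma> t = velocity (mfd G) I (\<lambda>x. right_translation G (\<gamma> t) (?\<alpha> x)) t"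
    by (rule velocity_cong[OF t]) (simp add: right_translation_def car t m_assoc)
  also have "\<dots> = tangent_map (mfd G) (mfd G) (right_translation G (\<gamma> t)) (?\<alpha> t) (velocity (mfd G) I ?\<alpha> t)"
    by (rule velocity_compose[OF manifold manifold smooth_map_right_translation[OF car[OF t]]
          smooth_curve_quotient[OF \<gamma> t] t no_isolated_point[OF t]])
  finally show ?thesis by (simp add: right_invariant_field_def log_velocity_def car t)
qed

text \<open>Integral curves of right-invariant fields are the solutions of \<open>\<gamma>' \<gamma>\<^sup>-\<^sup>1 = u\<close>.\<close>

lemma integral_curve_log_velocity:
  assumes \<gamma>: "integral_curve (mfd G) I (\<lambda>t. right_invariant_field G (u t)) \<gamma>"
    and t: "t \<in> I" and u: "u t \<in> lie_algebra G"
  shows "log_velocity G I \<gamma> t = u t"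
proof -
  have sm: "smooth_curve \<gamma>" and vel: "velocity (mfd G) I \<gamma> t = right_invariant_field G (u t) (\<gamma> t)"
    using \<gamma> t by (auto simp: integral_curve_def)
  show ?thesis
    unfolding log_velocity_eq_translated_velocity[OF sm t] vel right_invariant_field_def
    by (rule tangent_right_translation_inv[OF curve_carrier[OF sm t] u])
qed

text \<open>The quotient \<open>\<alpha> x \<otimes> \<beta> x \<otimes> inv (\<alpha> t \<otimes> \<beta> t)\<close> is the product of \<open>\<alpha> x \<otimes> inv (\<alpha> t)\<close> and the conjugate by
  \<open>\<alpha> t\<close> of \<open>\<beta> x \<otimes> inv (\<beta> t)\<close>. Both factors pass through the identity at time \<open>t\<close>.\<close>

lemma log_velocity_mult:
  assumes \<alpha>: "smooth_curve \<alpha>" and \<beta>: "smooth_curve \<beta>" and t: "t \<in> I"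
  shows "log_velocity G I (\<lambda>x. \<alpha> x \<otimes> \<beta> x) t =
    log_velocity G I \<alpha> t + Ad G (\<alpha> t) (log_velocity G I \<beta> t)"
proof -
  let ?a = "\<lambda>x. \<alpha> x \<otimes> inv (\<alpha> t)" and ?b = "\<lambda>x. \<beta> x \<otimes> inv (\<beta> t)"
  let ?c = "\<lambda>x. \<alpha> t \<otimes> x \<otimes> inv (\<alpha> t)"
  note car = curve_carrier[OF \<alpha>] curve_carrier[OF \<beta>]
  note cb = smooth_map_on_compose[OF smooth_manifold_real manifold manifold
      smooth_curve_quotient[OF \<beta> t] smooth_map_conjugation[OF car(1)[OF t]]
      smooth_map_on_image[OF smooth_curve_quotient[OF \<beta> t]]]
  have "log_velocity G I (\<lambda>x. \<alpha> x \<otimes> \<beta> x) t = velocity (mfd G) I (\<lambda>x. ?a x \<otimes> ?c (?b x)) t"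
    unfolding log_velocity_def
    by (rule velocity_cong[OF t]) (simp add: car t m_assoc inv_mult_group inv_solve_left)
  also have "\<dots> = velocity (mfd G) I ?a t + velocity (mfd G) I (\<lambda>x. ?c (?b x)) t"
    by (rule velocity_mult[OF smooth_curve_quotient[OF \<alpha> t] cb t]) (simp_all add: car t)
  also have "velocity (mfd G) I (\<lambda>x. ?c (?b x)) t = Ad G (\<alpha> t) (velocity (mfd G) I ?b t)"
    using velocity_compose[OF manifold manifold smooth_map_conjugation[OF car(1)[OF t]]
        smooth_curve_quotient[OF \<beta> t] t no_isolated_point[OF t]]
    by (simp add: Ad_def car t)
  finally show ?thesis unfolding log_velocity_def .
qed

text \<open>By the product rule the logarithmic derivative of \<open>\<alpha>\<^sup>-\<^sup>1 \<beta>\<close> depends on \<open>\<beta>\<close> only through its logarithmic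
  derivative, so it does not change when \<open>\<beta>\<close> is replaced by \<open>\<alpha>\<close>, which gives a constant curve.\<close>

lemma eq_if_log_velocity_eq:
  assumes \<alpha>: "smooth_curve \<alpha>" and \<beta>: "smooth_curve \<beta>" and I: "is_interval I"
    and eq: "\<And>t. t \<in> I \<Longrightarrow> log_velocity G I \<alpha> t = log_velocity G I \<beta> t"
    and s: "s \<in> I" "\<alpha> s = \<beta> s" and t: "t \<in> I"
  shows "\<alpha> t = \<beta> t"
proof -
  let ?i = "\<lambda>x. inv (\<alpha> x)" and ?\<psi> = "\<lambda>x. inv (\<alpha> x) \<otimes> \<beta> x"
  have i: "smooth_curve ?i" and \<psi>: "smooth_curve ?\<psi>"
    by (intro smooth_curve_intros \<alpha> \<beta>)+
  note car = curve_carrier[OF \<alpha>] curve_carrier[OF \<beta>]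
  have "velocity (mfd G) I ?\<psi> x = 0" if x: "x \<in> I" for x
  proof -
    have "log_velocity G I ?\<psi> x = log_velocity G I (\<lambda>x. ?i x \<otimes> \<alpha> x) x"
      by (simp add: log_velocity_mult i \<alpha> \<beta> eq x)
    also have "\<dots> = log_velocity G I (\<lambda>_. \<one>) x"
      by (rule log_velocity_cong[OF x]) (simp add: car)
    finally have "log_velocity G I ?\<psi> x = 0" by (simp add: log_velocity_const x)
    moreover have "linear (tangent_map (mfd G) (mfd G) (right_translation G (?\<psi> x)) \<one>)"
      by (intro tangent_map_linear manifold smooth_map_right_translation one_in_topspace
          curve_carrier[OF \<psi>] x)
    ultimately show ?thesis
      by (simp add: velocity_eq_right_invariant_field[OF \<psi> x] right_invariant_field_def linear_0)
  qed
  from velocity_zero_imp_constant[OF manifold \<psi> I this s(1) t]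
  have "inv (\<alpha> t) \<otimes> \<beta> t = \<one>" using s car by simp
  then show ?thesis using car t by (metis inv_closed inv_equality inv_inv)
qed

text \<open>Dividing by the value at time \<open>t\<close> makes all curves of the family pass through the identity at time
  \<open>t\<close>.\<close>

lemma smooth_log_velocity_family:
  assumes N: "smooth_manifold N"
    and \<kappa>: "smooth_map_on (prod_manifold real_manifold N) (I \<times> S) (mfd G) (\<lambda>(x, s). \<kappa> x s)"
    and S: "S \<subseteq> topspace (mtop N)" and t: "t \<in> I"
    and l: "linear (l :: ('a, 'b) tangent \<Rightarrow> real)"
  shows "smooth_map_on N S real_manifold (\<lambda>s. l (log_velocity G I (\<lambda>x. \<kappa> x s) t))"
proof -
  note RN = smooth_manifold_prod[OF smooth_manifold_real N]
  have sub: "I \<times> S \<subseteq> topspace (mtop real_manifold) \<times> topspace (mtop N)" using S by auto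
  have "smooth_map_on (prod_manifold real_manifold N) (I \<times> S) (prod_manifold real_manifold N) (\<lambda>p. (t, snd p))"
    by (intro smooth_map_on_Pair smooth_map_on_const smooth_map_on_snd RN smooth_manifold_real N sub)
      (use S in auto)
  from smooth_map_on_compose[OF RN RN manifold this \<kappa>] t
  have \<kappa>t: "smooth_map_on (prod_manifold real_manifold N) (I \<times> S) (mfd G) (\<lambda>p. \<kappa> t (snd p))" by auto
  have "smooth_map_on (prod_manifold real_manifold N) (I \<times> S) (mfd G)
      (\<lambda>p. (case p of (x, s) \<Rightarrow> \<kappa> x s) \<otimes> inv (\<kappa> t (snd p)))"
    by (intro smooth_map_on_mult smooth_map_on_inv RN \<kappa> \<kappa>t)
  then have q: "smooth_map_on (prod_manifold real_manifold N) (I \<times> S) (mfd G)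
      (\<lambda>(x, s). \<kappa> x s \<otimes> inv (\<kappa> t s))"
    by (simp add: case_prod_unfold)
  have "\<kappa> t s \<otimes> inv (\<kappa> t s) = \<one>" if "s \<in> S" for s
    using smooth_map_on_carrier[OF \<kappa>t, of "(t, s)"] that t by simp
  with smooth_velocity_family[OF manifold N q _ _ no_isolated_point, of "\<lambda>_. t"] l t
  show ?thesis
    unfolding log_velocity_def using S by (simp add: smooth_map_on_const)
qed

text \<open>The family of curves \<open>x \<mapsto> \<gamma> x \<otimes> inv (\<gamma> s)\<close> with parameter \<open>s\<close> passes through the identity at time
  \<open>s\<close>, so here the time at which the velocity is taken is the parameter itself.\<close>

lemma smooth_log_velocity:
  assumes \<gamma>: "smooth_curve \<gamma>" and l: "linear (l :: ('a, 'b) tangent \<Rightarrow> real)"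
  shows "smooth_map_on real_manifold I real_manifold (\<lambda>t. l (log_velocity G I \<gamma> t))"
proof -
  note R = smooth_manifold_real
  note RR = smooth_manifold_prod[OF R R]
  have "smooth_map_on (prod_manifold real_manifold real_manifold) (I \<times> I) real_manifold fst"
    "smooth_map_on (prod_manifold real_manifold real_manifold) (I \<times> I) real_manifold snd"
    by (auto intro!: smooth_map_on_fst smooth_map_on_snd R)
  from this[THEN smooth_map_on_compose[OF RR R manifold _ \<gamma>]]
  have "smooth_map_on (prod_manifold real_manifold real_manifold) (I \<times> I) (mfd G) (\<lambda>p. \<gamma> (fst p))"
    "smooth_map_on (prod_manifold real_manifold real_manifold) (I \<times> I) (mfd G) (\<lambda>p. \<gamma> (snd p))"
    by auto
  then have "smooth_map_on (prod_manifold real_manifold real_manifold) (I \<times> I) (mfd G)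
      (\<lambda>(x, s). \<gamma> x \<otimes> inv (\<gamma> s))"
    unfolding case_prod_unfold by (intro smooth_map_on_mult smooth_map_on_inv RR)
  from smooth_velocity_family[OF manifold R this smooth_map_on_id[OF R] _ no_isolated_point _ l]
  show ?thesis by (simp add: log_velocity_def curve_carrier[OF \<gamma>])
qed

end

section \<open>Cochains of degree one\<close>

lemma bounded_linear_apply_bcontfun:
  "bounded_linear (\<lambda>x :: 'a::topological_space \<Rightarrow>\<^sub>C 'b::real_normed_vector. apply_bcontfun x i)"
proof (rule bounded_linear_intro[of _ 1])
  show "norm (apply_bcontfun x i) \<le> norm x * 1" for x :: "'a \<Rightarrow>\<^sub>C 'b"
    by (simp add: norm_bounded)
qed auto

text \<open>Evaluation at index 0 is continuous and linear on bounded sequences, so the test in the definition of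
  \<open>smooth_on_power\<close> is the composition of the coordinate expression of \<open>f\<close> with a smooth map.\<close>

lemma smooth_on_power_one:
  assumes M: "smooth_manifold M" and f: "smooth_map M real_manifold f"
  shows "smooth_on_power M 1 (\<lambda>xs. f (xs ! 0))"
  unfolding smooth_on_power_def smooth_on_iff_smooth_at
proof (intro ballI)
  interpret M: smooth_manifold M by fact
  fix cs :: "('a, 'b) chart list" and x :: "nat \<Rightarrow>\<^sub>C 'b"
  let ?c = "cs ! 0"
  let ?X = "{x :: nat \<Rightarrow>\<^sub>C 'b. \<forall>i<1. apply_bcontfun x i \<in> snd (cs ! i) ` fst (cs ! i)}"
  assume cs: "cs \<in> tuples (atlas M) 1" and x: "x \<in> ?X"
  have c: "?c \<in> atlas M" using cs by (auto simp: tuples_def)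
  obtain p where p: "p \<in> fst ?c" "apply_bcontfun x 0 = snd ?c p" using x by auto
  have top: "fst ?c \<subseteq> topspace (mtop M)" by (rule M.chart_subset[OF c])
  have "?c \<in> charts_at M p" using c p by (simp add: charts_at_def)
  from smooth_map_on_germ[OF M smooth_manifold_real f _ this, of "(UNIV, id)"]
  have "smooth_at (snd ?c ` (topspace (mtop M) \<inter> fst ?c)) (f \<circ> chart_inv ?c) (apply_bcontfun x 0)"
    using p top by auto
  moreover have "apply_bcontfun y 0 \<in> snd ?c ` (topspace (mtop M) \<inter> fst ?c)" if "y \<in> ?X" for y
    using that top by (auto simp: inf.absorb2)
  ultimately have "smooth_at ?X (\<lambda>y. (f \<circ> chart_inv ?c) (apply_bcontfun y 0)) x"
    using smooth_at_compose[OF M.finite_dim_model smooth_at_bounded_linear[OF bounded_linear_apply_bcontfun] x]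
    by blast
  then show "smooth_at ?X (\<lambda>x. f (map (\<lambda>i. chart_inv (cs ! i) (apply_bcontfun x i)) [0..<1] ! 0)) x"
    by (simp add: comp_def)
qed

lemma tuples_one: "tuples A (Suc 0) = {[x] | x. x \<in> A}"
  by (auto simp: tuples_def length_Suc_conv)

lemma tuples_two: "tuples A (1 + 1) = {[x, y] | x y. x \<in> A \<and> y \<in> A}"
  by (auto simp: tuples_def length_Suc_conv)

lemma differential_zero: "differential H \<rho> 0 (\<lambda>_. u) [h] = \<rho> h u - u"
  by (simp add: differential_def scaleR_minus_left)

lemma differential_one:
  "differential H \<rho> 1 (\<lambda>hs. c (hs ! 0)) [h, k] = \<rho> h (c k) - c (h \<otimes>\<^bsub>H\<^esub> k) + c h"
  by (simp add: differential_def)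

section \<open>Deformations of homomorphisms\<close>

locale lie_group_deformation =
  lie_group_curves G I + H: lie_group H
  for H :: "('h, 'e::real_normed_vector) lie_group_data"
    and G :: "('g, 'f::real_normed_vector) lie_group_data" (structure)
    and I :: "real set" +
  fixes \<phi> :: "'h \<Rightarrow> 'g" and \<Phi> :: "real \<Rightarrow> 'h \<Rightarrow> 'g"
  assumes deformation: "deformation I H G \<phi> \<Phi>"
begin

lemma family_hom: "t \<in> I \<Longrightarrow> \<Phi> t \<in> hom H G"
  using deformation by (simp add: deformation_def lie_group_hom_def)

lemma hom_carrier: "t \<in> I \<Longrightarrow> h \<in> carrier H \<Longrightarrow> \<Phi> t h \<in> carrier G"
  using family_hom by (auto simp: hom_def)

lemma smooth_family:
  "smooth_map_on (prod_manifold real_manifold (mfd H)) (I \<times> carrier H) (mfd G) (\<lambda>(t, h). \<Phi> t h)"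
  using deformation by (simp add: deformation_def)

lemma smooth_orbit:
  assumes h: "h \<in> carrier H"
  shows "smooth_curve (\<lambda>x. \<Phi> x h)"
proof -
  note RH = smooth_manifold_prod[OF smooth_manifold_real H.manifold]
  have "smooth_map_on real_manifold I (prod_manifold real_manifold (mfd H)) (\<lambda>x. (x, h))"
    using h by (intro smooth_map_on_Pair smooth_map_on_id H.smooth_map_on_const_carrier
        smooth_manifold_real H.manifold) auto
  from smooth_map_on_compose[OF smooth_manifold_real RH manifold this smooth_family] h
  show ?thesis by simp
qed

lemma variation_eq_log_velocity:
  "t \<in> I \<Longrightarrow> h \<in> carrier H \<Longrightarrow> variation I G \<Phi> t h = log_velocity G I (\<lambda>x. \<Phi> x h) t"
  by (simp add: variation_def log_velocity_eq_translated_velocity smooth_orbit)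

lemma variation_mult:
  assumes t: "t \<in> I" and h: "h \<in> carrier H" and k: "k \<in> carrier H"
  shows "variation I G \<Phi> t (h \<otimes>\<^bsub>H\<^esub> k) = variation I G \<Phi> t h + Ad G (\<Phi> t h) (variation I G \<Phi> t k)"
proof -
  have "log_velocity G I (\<lambda>x. \<Phi> x (h \<otimes>\<^bsub>H\<^esub> k)) t = log_velocity G I (\<lambda>x. \<Phi> x h \<otimes> \<Phi> x k) t"
    by (rule log_velocity_cong[OF t]) (use family_hom h k in \<open>auto simp: hom_def\<close>)
  then show ?thesis
    using assms by (simp add: variation_eq_log_velocity log_velocity_mult smooth_orbit)
qed

lemma variation_cocycle:
  assumes t: "t \<in> I"
  shows "(\<lambda>hs. variation I G \<Phi> t (hs ! 0)) \<in> cocycles H (lie_algebra G) (Ad G \<circ> \<Phi> t) 1"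
  unfolding cocycles_def cochains_def
proof (intro CollectI conjI allI impI ballI)
  show "(\<lambda>hs. variation I G \<Phi> t (hs ! 0)) ` tuples (carrier H) 1 \<subseteq> lie_algebra G"
    using t log_velocity_in_lie_algebra[OF smooth_orbit t]
    by (auto simp: tuples_one variation_eq_log_velocity)
next
  fix l :: "('g, 'f) tangent \<Rightarrow> real" assume l: "linear l"
  have "smooth_map_on (mfd H) (carrier H) real_manifold (\<lambda>h. l (log_velocity G I (\<lambda>x. \<Phi> x h) t))"
    by (rule smooth_log_velocity_family[OF H.manifold smooth_family _ t l])
      (simp add: H.topspace_eq_carrier)
  from smooth_map_on_cong[OF H.manifold this, of "\<lambda>h. l (variation I G \<Phi> t h)"]
  have "smooth_map (mfd H) real_manifold (\<lambda>h. l (variation I G \<Phi> t h))"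
    using t by (simp add: variation_eq_log_velocity H.topspace_eq_carrier)
  from smooth_on_power_one[OF H.manifold this]
  show "smooth_on_power (mfd H) 1 (l \<circ> (\<lambda>hs. variation I G \<Phi> t (hs ! 0)))"
    by (simp add: comp_def)
next
  fix hs assume "hs \<in> tuples (carrier H) (1 + 1)"
  then obtain h k where "hs = [h, k]" "h \<in> carrier H" "k \<in> carrier H"
    unfolding tuples_two by blast
  then show "differential H (Ad G \<circ> \<Phi> t) 1 (\<lambda>hs. variation I G \<Phi> t (hs ! 0)) hs = 0"
    using differential_one[of H "Ad G \<circ> \<Phi> t" "variation I G \<Phi> t" h k] t
    by (simp add: variation_mult)
qed

text \<open>Take logarithmic derivatives on both sides of \<open>\<Phi> x h \<otimes> g x = g x \<otimes> \<phi> h\<close>. On the right, the factor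
  \<open>\<phi> h\<close> contributes nothing because it does not depend on \<open>x\<close>.\<close>

lemma trivial_imp_transgression:
  assumes "trivial_deformation I H G \<phi> \<Phi>" and \<phi>: "\<phi> \<in> hom H G"
  shows "\<exists>u. smooth_transgression I H G \<Phi> u"
proof -
  obtain g where g: "smooth_curve g"
    and conj: "\<And>h t. h \<in> carrier H \<Longrightarrow> t \<in> I \<Longrightarrow> \<Phi> t h = g t \<otimes> \<phi> h \<otimes> inv (g t)"
    using assms(1) by (auto simp: trivial_deformation_def)
  note car = curve_carrier[OF g]
  let ?a = "log_velocity G I g"
  have "smooth_transgression I H G \<Phi> (\<lambda>t. - ?a t)"
    unfolding smooth_transgression_def smooth_into_vector_space_def
  proof (intro conjI allI impI ballI)
    show "(\<lambda>t. - ?a t) ` I \<subseteq> lie_algebra G"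
      by (auto intro: tangent_space_uminus manifold log_velocity_in_lie_algebra g)
  next
    fix l :: "('g, 'f) tangent \<Rightarrow> real" assume l: "linear l"
    from smooth_log_velocity[OF g linear_compose_neg[OF l]]
    show "smooth_map_on real_manifold I real_manifold (l \<circ> (\<lambda>t. - ?a t))"
      by (simp add: comp_def linear_neg[OF l])
  next
    fix t h assume t: "t \<in> I" and h: "h \<in> carrier H"
    have \<phi>h: "\<phi> h \<in> carrier G" using \<phi> h by (auto simp: hom_def)
    have "log_velocity G I (\<lambda>x. \<Phi> x h \<otimes> g x) t = log_velocity G I (\<lambda>x. g x \<otimes> \<phi> h) t"
      by (rule log_velocity_cong[OF t]) (simp add: conj h car \<phi>h m_assoc)
    then have "variation I G \<Phi> t h + Ad G (\<Phi> t h) (?a t) = ?a t"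
      using Ad_linear[OF car[OF t]]
      by (simp add: log_velocity_mult smooth_orbit smooth_curve_intros g h t \<phi>h
          variation_eq_log_velocity log_velocity_const linear_0)
    then show "differential H (Ad G \<circ> \<Phi> t) 0 (\<lambda>_. - ?a t) [h] = variation I G \<Phi> t h"
      unfolding differential_zero using linear_neg[OF Ad_linear[OF hom_carrier[OF t h]]]
      by (simp add: algebra_simps)
  qed
  then show ?thesis by (rule exI[of _ "\<lambda>t. - ?a t"])
qed

text \<open>Both \<open>\<Phi> x h \<otimes> \<gamma> x\<close> and \<open>\<gamma> x \<otimes> \<phi> h\<close> start at \<open>\<phi> h\<close>. The logarithmic derivative of the second is that of
  \<open>\<gamma>\<close>, which is \<open>- u\<close>. With \<open>X\<^sub>t = variation I G \<Phi> t\<close>, that of the first is \<open>X\<^sub>t(h) - Ad (\<Phi> t h) (u t)\<close>, which is also \<open>- u t\<close> by the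
  transgression equation.\<close>

lemma transgression_imp_trivial:
  assumes u: "smooth_transgression I H G \<Phi> u" and complete: "complete_transgression I G u"
    and I: "is_interval I" "0 \<in> I" and \<phi>: "\<phi> \<in> hom H G"
  shows "trivial_deformation I H G \<phi> \<Phi>"
proof -
  obtain \<gamma> where \<gamma>0: "\<gamma> 0 = \<one>"
    and integral: "integral_curve (mfd G) I (\<lambda>t. right_invariant_field G (- u t)) \<gamma>"
    using complete by (auto simp: complete_transgression_def)
  have \<gamma>: "smooth_curve \<gamma>" using integral by (simp add: integral_curve_def)
  note car = curve_carrier[OF \<gamma>]
  have "\<Phi> t h = \<gamma> t \<otimes> \<phi> h \<otimes> inv (\<gamma> t)" if h: "h \<in> carrier H" and t: "t \<in> I" for h t
  proof -
    have \<phi>h: "\<phi> h \<in> carrier G" using \<phi> h by (auto simp: hom_def)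
    have "\<Phi> t h \<otimes> \<gamma> t = \<gamma> t \<otimes> \<phi> h"
    proof (rule eq_if_log_velocity_eq[OF _ _ I(1) _ I(2) _ t])
      show "smooth_curve (\<lambda>x. \<Phi> x h \<otimes> \<gamma> x)" "smooth_curve (\<lambda>x. \<gamma> x \<otimes> \<phi> h)"
        by (intro smooth_curve_intros smooth_orbit \<gamma> h \<phi>h)+
      show "\<Phi> 0 h \<otimes> \<gamma> 0 = \<gamma> 0 \<otimes> \<phi> h"
        using deformation h \<phi>h by (simp add: deformation_def \<gamma>0)
      fix s assume s: "s \<in> I"
      have "u s \<in> lie_algebra G"
        using u s by (auto simp: smooth_transgression_def smooth_into_vector_space_def)
      then have "log_velocity G I \<gamma> s = - u s"
        by (intro integral_curve_log_velocity[OF integral s] tangent_space_uminus manifold)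
      moreover have "variation I G \<Phi> s h = Ad G (\<Phi> s h) (u s) - u s"
        using u s h differential_zero[of H "Ad G \<circ> \<Phi> s" "u s" h]
        by (simp add: smooth_transgression_def)
      ultimately show "log_velocity G I (\<lambda>x. \<Phi> x h \<otimes> \<gamma> x) s = log_velocity G I (\<lambda>x. \<gamma> x \<otimes> \<phi> h) s"
        using Ad_linear[OF car[OF s]] linear_neg[OF Ad_linear[OF hom_carrier[OF s h]]]
        by (simp add: log_velocity_mult smooth_orbit smooth_curve_intros \<gamma> h s \<phi>h
            variation_eq_log_velocity[symmetric] log_velocity_const linear_0)
    qed
    then show ?thesis
      using car[OF t] \<phi>h hom_carrier[OF t h] by (simp add: inv_solve_right)
  qed
  then show ?thesis
    unfolding trivial_deformation_def using \<gamma> \<gamma>0 by blast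
qed

end

theorem theorem1p1:
  fixes H :: "('h, 'e::real_normed_vector) lie_group_data"
    and G :: "('g, 'f::real_normed_vector) lie_group_data"
    and I :: "real set"
    and \<phi> :: "'h \<Rightarrow> 'g"
    and \<Phi> :: "real \<Rightarrow> 'h \<Rightarrow> 'g"
  assumes "lie_group H" and "lie_group G"
    and "is_interval I" and "0 \<in> I" and "I \<noteq> {0}"
    and "lie_group_hom H G \<phi>"
    and "deformation I H G \<phi> \<Phi>"
  shows "(\<forall>t\<in>I. (\<lambda>hs. variation I G \<Phi> t (hs ! 0)) \<in> cocycles H (lie_algebra G) (Ad G \<circ> \<Phi> t) 1)
    \<and> ((\<forall>u. smooth_transgression I H G \<Phi> u \<longrightarrow> complete_transgression I G u) \<longrightarrow>
        (trivial_deformation I H G \<phi> \<Phi> \<longleftrightarrow> (\<exists>u. smooth_transgression I H G \<Phi> u)))"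
proof -
  have "at t within I \<noteq> bot" if "t \<in> I" for t
  proof -
    have "I \<noteq> {x}" for x using assms(4,5) by auto
    from connected_imp_perfect[OF is_interval_connected[OF assms(3)] that this]
    show ?thesis by (simp add: trivial_limit_within)
  qed
  then interpret lie_group_deformation H G I \<phi> \<Phi>
    using assms by (simp add: lie_group_deformation_def lie_group_curves_def
        lie_group_curves_axioms_def lie_group_deformation_axioms_def)
  have "\<phi> \<in> hom H G" using assms(6) by (simp add: lie_group_hom_def)
  then show ?thesis
    using variation_cocycle trivial_imp_transgression transgression_imp_trivial assms(3,4) by blast
qed

end
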